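(* The full and faithful functor $\mathrm{Alg}(\mathcal{E})\to\mathbf{CCH}$, sending an Eilenberg-Moore algebra $\alpha:\mathcal{E}(X)\to X$ of the expectation monad to the set $X$ with its induced convex structure $\alpha\circ\sigma_X$ and its induced compact Hausdorff topology $\alpha\circ\tau_X$ (and a homomorphism to its underlying function), restricts to an isomorphism of categories $$\mathrm{Alg}_{\mathrm{obs}}(\mathcal{E})\;\cong\;\mathbf{CCH}_{\mathrm{obs}}$$ between the full subcategory of observable $\mathcal{E}$-algebras and the full subcategory of observable convex compact Hausdorff spaces.
   Context: Effect algebra: a set $E$ with a partial commutative associative operation $\oplus$ with neutral element $0$ and a map $(-)^\perp$ such that, with $1:=0^\perp$, $x^\perp$ is the unique element with $x\oplus x^\perp=1$, and $x\oplus 1$ is defined only if $x=0$. Effect module: an effect algebra with scalar multiplication $[0,1]\times E\to E$ with $1x=x$, $(rs)x=r(sx)$, $(r+s)x=rx\oplus sx$ if $r+s\le1$, and $r(x\oplus y)=rx\oplus ry$ if $x\oplus y$ is defined. Category $\mathbf{EMod}$: maps preserve $1$, defined sums $\oplus$, and scalar multiplication. For a set $X$, $[0,1]^X$ is an effect module with pointwise structure ($p\oplus q=p+q$ defined iff $p(x)+q(x)\le1$ for all $x$). Expectation monad on $\mathbf{Sets}$: $\mathcal{E}(X)=\mathbf{EMod}([0,1]^X,[0,1])$, $\mathcal{E}(f)(h)(p)=h(p\circ f)$, unit $\eta(x)(p)=p(x)$, multiplication $\mu(h)(p)=h(\lambda k\in\mathcal{E}(X).\,k(p))$. $\mathcal{D}$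 is the monad of finitely supported discrete probability distributions on $\mathbf{Sets}$; its algebras are called convex sets and its algebra maps affine functions. $\mathcal{UF}$ is the ultrafilter monad; its algebras are the compact Hausdorff spaces (with continuous maps): for an algebra $a:\mathcal{UF}(X)\to X$, a subset $U$ is closed iff $U\in\mathcal{F}$ implies $a(\mathcal{F})\in U$ for all ultrafilters $\mathcal{F}$. There are maps of monads $\sigma:\mathcal{D}\Rightarrow\mathcal{E}$, $\sigma(\varphi)(p)=\sum_x\varphi(x)p(x)$, and $\tau:\mathcal{UF}\Rightarrow\mathcal{E}$, $\tau(\mathcal{F})(p)=\inf\{s\in[0,1]\mid\{x\mid p(x)\le s\}\in\mathcal{F}\}$; precomposing an $\mathcal{E}$-algebra with them gives a $\mathcal{D}$-algebra and a $\mathcal{UF}$-algebra. $\mathbf{CCH}$: sets carrying both a convex structure ($\mathcal{D}$-algebra) and a compact Hausdorff topology ($\mathcal{UF}$-algebra), with affine continuous maps. $X\in\mathbf{CCH}$ is observable if for $x,x'\in X$: $q(x)=q(x')$ for all affine continuous $q:X\to[0,1]$ implies $x=x'$. An $\mathcal{E}$-algebra is observable if its underlying convex compact Hausdorff space is. *)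

theory Defs
  imports "HOL-Analysis.Analysis" "HOL-Probability.Probability_Mass_Function"
begin

text \<open>
  Hom-sets are indexed by source and target and need not be disjoint, so composition, identities
  and the arrow part of a functor take the objects involved as arguments.
  \<open>cmp C A B D g f\<close> is the composite of \<open>f\<close> from \<open>A\<close> to \<open>B\<close> with \<open>g\<close> from \<open>B\<close> to \<open>D\<close>.
\<close>

record ('o, 'm) category =
  obj :: "'o set"
  hom :: "'o \<Rightarrow> 'o \<Rightarrow> 'm set"
  ident :: "'o \<Rightarrow> 'm"
  cmp :: "'o \<Rightarrow> 'o \<Rightarrow> 'o \<Rightarrow> 'm \<Rightarrow> 'm \<Rightarrow> 'm"

definition is_category :: "('o, 'm) category \<Rightarrow> bool" where
  "is_category C \<longleftrightarrow>
     (\<forall>A\<in>obj C. ident C A \<in> hom C A A) \<and>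
     (\<forall>A\<in>obj C. \<forall>B\<in>obj C. \<forall>D\<in>obj C. \<forall>f\<in>hom C A B. \<forall>g\<in>hom C B D.
        cmp C A B D g f \<in> hom C A D) \<and>
     (\<forall>A\<in>obj C. \<forall>B\<in>obj C. \<forall>f\<in>hom C A B.
        cmp C A A B f (ident C A) = f \<and> cmp C A B B (ident C B) f = f) \<and>
     (\<forall>A\<in>obj C. \<forall>B\<in>obj C. \<forall>D\<in>obj C. \<forall>E\<in>obj C.
        \<forall>f\<in>hom C A B. \<forall>g\<in>hom C B D. \<forall>h\<in>hom C D E.
        cmp C A D E h (cmp C A B D g f) = cmp C A B E (cmp C B D E h g) f)"

definition full_subcategory :: "('o, 'm) category \<Rightarrow> ('o \<Rightarrow> bool) \<Rightarrow> ('o, 'm) category" where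
  "full_subcategory C P = C\<lparr>obj := {A \<in> obj C. P A}\<rparr>"

record ('o, 'm, 'p, 'n) functor_data =
  fobj :: "'o \<Rightarrow> 'p"
  farr :: "'o \<Rightarrow> 'o \<Rightarrow> 'm \<Rightarrow> 'n"

definition is_functor ::
  "('o, 'm) category \<Rightarrow> ('p, 'n) category \<Rightarrow> ('o, 'm, 'p, 'n) functor_data \<Rightarrow> bool" where
  "is_functor C D F \<longleftrightarrow>
     is_category C \<and> is_category D \<and>
     (\<forall>A\<in>obj C. fobj F A \<in> obj D) \<and>
     (\<forall>A\<in>obj C. \<forall>B\<in>obj C. \<forall>f\<in>hom C A B. farr F A B f \<in> hom D (fobj F A) (fobj F B)) \<and>
     (\<forall>A\<in>obj C. farr F A A (ident C A) = ident D (fobj F A)) \<and>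
     (\<forall>A\<in>obj C. \<forall>B\<in>obj C. \<forall>E\<in>obj C. \<forall>f\<in>hom C A B. \<forall>g\<in>hom C B E.
        farr F A E (cmp C A B E g f) =
        cmp D (fobj F A) (fobj F B) (fobj F E) (farr F B E g) (farr F A B f))"

definition is_full ::
  "('o, 'm) category \<Rightarrow> ('p, 'n) category \<Rightarrow> ('o, 'm, 'p, 'n) functor_data \<Rightarrow> bool" where
  "is_full C D F \<longleftrightarrow>
     (\<forall>A\<in>obj C. \<forall>B\<in>obj C. farr F A B ` hom C A B = hom D (fobj F A) (fobj F B))"

definition is_faithful :: "('o, 'm) category \<Rightarrow> ('o, 'm, 'p, 'n) functor_data \<Rightarrow> bool" where
  "is_faithful C F \<longleftrightarrow> (\<forall>A\<in>obj C. \<forall>B\<in>obj C. inj_on (farr F A B) (hom C A B))"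

definition is_category_iso ::
  "('o, 'm) category \<Rightarrow> ('p, 'n) category \<Rightarrow> ('o, 'm, 'p, 'n) functor_data \<Rightarrow> bool" where
  "is_category_iso C D F \<longleftrightarrow>
     is_functor C D F \<and>
     (\<exists>G. is_functor D C G \<and>
        (\<forall>A\<in>obj C. fobj G (fobj F A) = A) \<and>
        (\<forall>B\<in>obj D. fobj F (fobj G B) = B) \<and>
        (\<forall>A\<in>obj C. \<forall>A'\<in>obj C. \<forall>f\<in>hom C A A'.
           farr G (fobj F A) (fobj F A') (farr F A A' f) = f) \<and>
        (\<forall>B\<in>obj D. \<forall>B'\<in>obj D. \<forall>g\<in>hom D B B'.
           farr F (fobj G B) (fobj G B') (farr G B B' g) = g))"

record 'e effect_module =
  ecarrier :: "'e set"
  eplus :: "'e \<Rightarrow> 'e \<Rightarrow> 'e option"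
  ezero :: 'e
  ecompl :: "'e \<Rightarrow> 'e"
  escale :: "real \<Rightarrow> 'e \<Rightarrow> 'e"

definition eone :: "'e effect_module \<Rightarrow> 'e" where
  "eone M = ecompl M (ezero M)"

text \<open>The sum is defined exactly when \<^const>\<open>eplus\<close> returns a \<^const>\<open>Some\<close>; the associativity
  axiom below is an equation between partial expressions, including definedness.\<close>

locale effect_algebra =
  fixes M :: "'e effect_module"
  assumes zero_closed: "ezero M \<in> ecarrier M"
    and compl_closed: "x \<in> ecarrier M \<Longrightarrow> ecompl M x \<in> ecarrier M"
    and plus_closed: "\<lbrakk>x \<in> ecarrier M; y \<in> ecarrier M; eplus M x y = Some z\<rbrakk> \<Longrightarrow> z \<in> ecarrier M"
    and plus_commute: "\<lbrakk>x \<in> ecarrier M; y \<in> ecarrier M\<rbrakk> \<Longrightarrow> eplus M x y = eplus M y x"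
    and plus_assoc: "\<lbrakk>x \<in> ecarrier M; y \<in> ecarrier M; z \<in> ecarrier M\<rbrakk> \<Longrightarrow>
      Option.bind (eplus M y z) (\<lambda>w. eplus M x w) = Option.bind (eplus M x y) (\<lambda>w. eplus M w z)"
    and plus_zero: "x \<in> ecarrier M \<Longrightarrow> eplus M x (ezero M) = Some x"
    and plus_compl: "\<lbrakk>x \<in> ecarrier M; y \<in> ecarrier M\<rbrakk> \<Longrightarrow>
      eplus M x y = Some (eone M) \<longleftrightarrow> y = ecompl M x"
    and plus_one: "\<lbrakk>x \<in> ecarrier M; eplus M x (eone M) \<noteq> None\<rbrakk> \<Longrightarrow> x = ezero M"

locale effect_module = effect_algebra +
  assumes scale_closed: "\<lbrakk>r \<in> {0..1}; x \<in> ecarrier M\<rbrakk> \<Longrightarrow> escale M r x \<in> ecarrier M"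
    and scale_one: "x \<in> ecarrier M \<Longrightarrow> escale M 1 x = x"
    and scale_scale: "\<lbrakk>r \<in> {0..1}; s \<in> {0..1}; x \<in> ecarrier M\<rbrakk> \<Longrightarrow>
      escale M (r * s) x = escale M r (escale M s x)"
    and scale_plus_left: "\<lbrakk>r \<in> {0..1}; s \<in> {0..1}; r + s \<le> 1; x \<in> ecarrier M\<rbrakk> \<Longrightarrow>
      eplus M (escale M r x) (escale M s x) = Some (escale M (r + s) x)"
    and scale_plus_right: "\<lbrakk>r \<in> {0..1}; x \<in> ecarrier M; y \<in> ecarrier M; eplus M x y = Some z\<rbrakk> \<Longrightarrow>
      eplus M (escale M r x) (escale M r y) = Some (escale M r z)"

text \<open>Maps with a carrier set as domain are represented as extensional functions, so that equality
  of functions is equality on the carrier.\<close>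

definition emod_hom :: "'e effect_module \<Rightarrow> 'f effect_module \<Rightarrow> ('e \<Rightarrow> 'f) set" where
  "emod_hom M N = {h \<in> ecarrier M \<rightarrow>\<^sub>E ecarrier N.
     h (eone M) = eone N \<and>
     (\<forall>x\<in>ecarrier M. \<forall>y\<in>ecarrier M. \<forall>z. eplus M x y = Some z \<longrightarrow> eplus N (h x) (h y) = Some (h z)) \<and>
     (\<forall>r\<in>{0..1}. \<forall>x\<in>ecarrier M. h (escale M r x) = escale N r (h x))}"

definition unit_emod :: "real effect_module" where
  "unit_emod = \<lparr>ecarrier = {0..1},
     eplus = (\<lambda>x y. if x + y \<le> 1 then Some (x + y) else None),
     ezero = 0,
     ecompl = (\<lambda>x. 1 - x),
     escale = (\<lambda>r x. r * x)\<rparr>"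

abbreviation preds :: "'a set \<Rightarrow> ('a \<Rightarrow> real) set" where
  "preds X \<equiv> X \<rightarrow>\<^sub>E {0..1}"

definition pred_emod :: "'a set \<Rightarrow> ('a \<Rightarrow> real) effect_module" where
  "pred_emod X = \<lparr>ecarrier = preds X,
     eplus = (\<lambda>p q. if \<forall>x\<in>X. p x + q x \<le> 1 then Some (\<lambda>x\<in>X. p x + q x) else None),
     ezero = (\<lambda>x\<in>X. 0),
     ecompl = (\<lambda>p. \<lambda>x\<in>X. 1 - p x),
     escale = (\<lambda>r p. \<lambda>x\<in>X. r * p x)\<rparr>"

lemma effect_module_unit_emod: "effect_module unit_emod"
proof
  fix r s x :: real
  assume "r \<in> {0..1}" "s \<in> {0..1}" "r + s \<le> 1" "x \<in> ecarrier unit_emod"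
  then show "eplus unit_emod (escale unit_emod r x) (escale unit_emod s x) =
    Some (escale unit_emod (r + s) x)"
    using mult_le_one[of "r + s" x] by (simp add: unit_emod_def distrib_right)
next
  fix r x y z :: real
  assume "r \<in> {0..1}" "x \<in> ecarrier unit_emod" "y \<in> ecarrier unit_emod"
    "eplus unit_emod x y = Some z"
  then show "eplus unit_emod (escale unit_emod r x) (escale unit_emod r y) =
    Some (escale unit_emod r z)"
    using mult_le_one[of r "x + y"] by (auto simp: unit_emod_def distrib_left split: if_splits)
qed (auto simp: unit_emod_def eone_def mult_le_one split: if_splits)

lemma effect_module_pred_emod: "effect_module (pred_emod X)"
proof -
  have ext: "p = q" if "p \<in> preds X" "q \<in> preds X" "\<And>x. x \<in> X \<Longrightarrow> p x = q x" for p q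
    using that by (rule PiE_ext)
  have in01: "0 \<le> p x \<and> p x \<le> 1" if "p \<in> preds X" "x \<in> X" for p x
    using that by (auto dest: PiE_mem)
  note defs = pred_emod_def eone_def
  show ?thesis
  proof
    show "ezero (pred_emod X) \<in> ecarrier (pred_emod X)" by (simp add: defs)
  next
    fix p assume "p \<in> ecarrier (pred_emod X)"
    then show "ecompl (pred_emod X) p \<in> ecarrier (pred_emod X)" by (auto simp: defs dest: in01)
  next
    fix p q r assume "p \<in> ecarrier (pred_emod X)" "q \<in> ecarrier (pred_emod X)"
      "eplus (pred_emod X) p q = Some r"
    then show "r \<in> ecarrier (pred_emod X)"
      by (auto simp: defs dest: in01 split: if_splits intro!: add_nonneg_nonneg)
  next
    fix p q
    show "eplus (pred_emod X) p q = eplus (pred_emod X) q p" by (simp add: defs add.commute)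
  next
    fix p q r assume a: "p \<in> ecarrier (pred_emod X)" "q \<in> ecarrier (pred_emod X)"
      "r \<in> ecarrier (pred_emod X)"
    then have nn: "0 \<le> p x \<and> 0 \<le> q x \<and> 0 \<le> r x" if "x \<in> X" for x
      using that by (auto simp: defs dest: in01)
    have 1: "(\<forall>x\<in>X. q x + r x \<le> 1) \<and> (\<forall>x\<in>X. p x + (q x + r x) \<le> 1) \<longleftrightarrow>
      (\<forall>x\<in>X. p x + q x + r x \<le> 1)"
      using nn by (fastforce simp: add.assoc)
    have 2: "(\<forall>x\<in>X. p x + q x \<le> 1) \<and> (\<forall>x\<in>X. p x + q x + r x \<le> 1) \<longleftrightarrow>
      (\<forall>x\<in>X. p x + q x + r x \<le> 1)"
      using nn by fastforce
    show "Option.bind (eplus (pred_emod X) q r) (\<lambda>w. eplus (pred_emod X) p w) =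
      Option.bind (eplus (pred_emod X) p q) (\<lambda>w. eplus (pred_emod X) w r)"
      using 1 2 by (auto simp: defs add.assoc fun_eq_iff)
  next
    fix p assume "p \<in> ecarrier (pred_emod X)"
    then show "eplus (pred_emod X) p (ezero (pred_emod X)) = Some p"
      by (auto simp: defs dest: in01 intro!: ext)
  next
    fix p q assume a: "p \<in> ecarrier (pred_emod X)" "q \<in> ecarrier (pred_emod X)"
    have "eplus (pred_emod X) p q = Some (eone (pred_emod X)) \<longleftrightarrow> (\<forall>x\<in>X. p x + q x = 1)"
      by (auto simp: defs fun_eq_iff restrict_def split: if_splits) (metis order_refl)
    also have "\<dots> \<longleftrightarrow> (\<forall>x\<in>X. q x = 1 - p x)" by (auto simp: algebra_simps)
    also have "\<dots> \<longleftrightarrow> q = ecompl (pred_emod X) p"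
      using a by (auto simp: defs dest: in01 intro!: ext)
    finally show "eplus (pred_emod X) p q = Some (eone (pred_emod X)) \<longleftrightarrow> q = ecompl (pred_emod X) p" .
  next
    fix p assume a: "p \<in> ecarrier (pred_emod X)" "eplus (pred_emod X) p (eone (pred_emod X)) \<noteq> None"
    then have "p x = 0" if "x \<in> X" for x
      using that in01[of p x] by (auto simp: defs split: if_splits)
    with a show "p = ezero (pred_emod X)" by (auto simp: defs intro!: ext)
  next
    fix r p assume "r \<in> {0..1::real}" "p \<in> ecarrier (pred_emod X)"
    then show "escale (pred_emod X) r p \<in> ecarrier (pred_emod X)"
      by (auto simp: defs dest: in01 intro!: mult_le_one)
  next
    fix p assume "p \<in> ecarrier (pred_emod X)"
    then show "escale (pred_emod X) 1 p = p" by (auto simp: defs dest: in01 intro!: ext)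
  next
    fix r s p
    show "escale (pred_emod X) (r * s) p = escale (pred_emod X) r (escale (pred_emod X) s p)"
      by (auto simp: defs fun_eq_iff)
  next
    fix r s :: real and p
    assume rs: "r \<in> {0..1}" "s \<in> {0..1}" "r + s \<le> 1" and p: "p \<in> ecarrier (pred_emod X)"
    have "r * p x + s * p x \<le> 1" if "x \<in> X" for x
    proof -
      have "(r + s) * p x \<le> 1"
        using rs p in01[OF _ that, of p] by (intro mult_le_one) (auto simp: defs)
      then show ?thesis by (simp add: distrib_right)
    qed
    then show "eplus (pred_emod X) (escale (pred_emod X) r p) (escale (pred_emod X) s p) =
      Some (escale (pred_emod X) (r + s) p)"
      by (auto simp: defs fun_eq_iff distrib_right)
  next
    fix r :: real and p q z
    assume r: "r \<in> {0..1}" and p: "p \<in> ecarrier (pred_emod X)" "q \<in> ecarrier (pred_emod X)"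
      and z: "eplus (pred_emod X) p q = Some z"
    have "r * p x + r * q x \<le> 1" if "x \<in> X" for x
    proof -
      have "r * (p x + q x) \<le> 1"
        using r z p that in01[OF _ that, of p] in01[OF _ that, of q]
        by (intro mult_le_one) (auto simp: defs split: if_splits)
      then show ?thesis by (simp add: distrib_left)
    qed
    moreover have "z = (\<lambda>x\<in>X. p x + q x)" using z by (auto simp: defs split: if_splits)
    ultimately show "eplus (pred_emod X) (escale (pred_emod X) r p) (escale (pred_emod X) r q) =
      Some (escale (pred_emod X) r z)"
      by (auto simp: defs fun_eq_iff distrib_left)
  qed
qed

definition Exp :: "'a set \<Rightarrow> (('a \<Rightarrow> real) \<Rightarrow> real) set" where
  "Exp X = emod_hom (pred_emod X) unit_emod"

definition Exp_map ::
  "'a set \<Rightarrow> 'b set \<Rightarrow> ('a \<Rightarrow> 'b) \<Rightarrow> (('a \<Rightarrow> real) \<Rightarrow> real) \<Rightarrow> (('b \<Rightarrow> real) \<Rightarrow> real)" where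
  "Exp_map X Y f h = (\<lambda>p\<in>preds Y. h (\<lambda>x\<in>X. p (f x)))"

definition Exp_unit :: "'a set \<Rightarrow> 'a \<Rightarrow> (('a \<Rightarrow> real) \<Rightarrow> real)" where
  "Exp_unit X x = (\<lambda>p\<in>preds X. p x)"

definition Exp_mult ::
  "'a set \<Rightarrow> (((('a \<Rightarrow> real) \<Rightarrow> real) \<Rightarrow> real) \<Rightarrow> real) \<Rightarrow> (('a \<Rightarrow> real) \<Rightarrow> real)" where
  "Exp_mult X h = (\<lambda>p\<in>preds X. h (\<lambda>k\<in>Exp X. k p))"

record 'a exp_alg =
  acarrier :: "'a set"
  astruct :: "(('a \<Rightarrow> real) \<Rightarrow> real) \<Rightarrow> 'a"

definition is_exp_alg :: "'a exp_alg \<Rightarrow> bool" where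
  "is_exp_alg A \<longleftrightarrow> (let X = acarrier A; \<alpha> = astruct A in
     \<alpha> \<in> Exp X \<rightarrow>\<^sub>E X \<and>
     (\<forall>x\<in>X. \<alpha> (Exp_unit X x) = x) \<and>
     (\<forall>h\<in>Exp (Exp X). \<alpha> (Exp_mult X h) = \<alpha> (Exp_map (Exp X) X \<alpha> h)))"

definition exp_alg_hom :: "'a exp_alg \<Rightarrow> 'b exp_alg \<Rightarrow> ('a \<Rightarrow> 'b) set" where
  "exp_alg_hom A B = {f \<in> acarrier A \<rightarrow>\<^sub>E acarrier B.
     \<forall>h\<in>Exp (acarrier A). f (astruct A h) = astruct B (Exp_map (acarrier A) (acarrier B) f h)}"

definition Alg_Exp :: "('a exp_alg, 'a \<Rightarrow> 'a) category" where
  "Alg_Exp = \<lparr>obj = Collect is_exp_alg,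
     hom = exp_alg_hom,
     ident = (\<lambda>A. \<lambda>x\<in>acarrier A. x),
     cmp = (\<lambda>A B C g f. compose (acarrier A) g f)\<rparr>"

definition Dist :: "'a set \<Rightarrow> 'a pmf set" where
  "Dist X = {\<phi>. finite (set_pmf \<phi>) \<and> set_pmf \<phi> \<subseteq> X}"

definition is_convex_structure :: "'a set \<Rightarrow> ('a pmf \<Rightarrow> 'a) \<Rightarrow> bool" where
  "is_convex_structure X c \<longleftrightarrow>
     c \<in> Dist X \<rightarrow>\<^sub>E X \<and>
     (\<forall>x\<in>X. c (return_pmf x) = x) \<and>
     (\<forall>\<Phi>\<in>Dist (Dist X). c (join_pmf \<Phi>) = c (map_pmf c \<Phi>))"

text \<open>The convex structure and the topology are not required to be compatible.\<close>

record 'a cch =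
  ccarrier :: "'a set"
  cconv :: "'a pmf \<Rightarrow> 'a"
  ctop :: "'a topology"

definition is_cch :: "'a cch \<Rightarrow> bool" where
  "is_cch Y \<longleftrightarrow>
     is_convex_structure (ccarrier Y) (cconv Y) \<and>
     topspace (ctop Y) = ccarrier Y \<and> compact_space (ctop Y) \<and> Hausdorff_space (ctop Y)"

definition cch_hom :: "'a cch \<Rightarrow> 'b cch \<Rightarrow> ('a \<Rightarrow> 'b) set" where
  "cch_hom Y Z = {f \<in> ccarrier Y \<rightarrow>\<^sub>E ccarrier Z.
     (\<forall>\<phi>\<in>Dist (ccarrier Y). f (cconv Y \<phi>) = cconv Z (map_pmf f \<phi>)) \<and>
     continuous_map (ctop Y) (ctop Z) f}"

definition CCH :: "('a cch, 'a \<Rightarrow> 'a) category" where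
  "CCH = \<lparr>obj = Collect is_cch,
     hom = cch_hom,
     ident = (\<lambda>Y. \<lambda>x\<in>ccarrier Y. x),
     cmp = (\<lambda>Y Z W g f. compose (ccarrier Y) g f)\<rparr>"

definition unit_cch :: "real cch" where
  "unit_cch = \<lparr>ccarrier = {0..1},
     cconv = (\<lambda>\<phi>\<in>Dist {0..1}. \<Sum>x\<in>set_pmf \<phi>. pmf \<phi> x * x),
     ctop = top_of_set {0..1}\<rparr>"

definition observable_cch :: "'a cch \<Rightarrow> bool" where
  "observable_cch Y \<longleftrightarrow>
     (\<forall>x\<in>ccarrier Y. \<forall>x'\<in>ccarrier Y. (\<forall>q\<in>cch_hom Y unit_cch. q x = q x') \<longrightarrow> x = x')"

definition ultrafilters :: "'a set \<Rightarrow> 'a set set set" where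
  "ultrafilters X = {F. F \<subseteq> Pow X \<and> X \<in> F \<and> {} \<notin> F \<and>
     (\<forall>A\<in>F. \<forall>B\<in>F. A \<inter> B \<in> F) \<and>
     (\<forall>A\<in>F. \<forall>B. A \<subseteq> B \<and> B \<subseteq> X \<longrightarrow> B \<in> F) \<and>
     (\<forall>A. A \<subseteq> X \<longrightarrow> A \<in> F \<or> X - A \<in> F)}"

definition dist_to_exp :: "'a set \<Rightarrow> 'a pmf \<Rightarrow> (('a \<Rightarrow> real) \<Rightarrow> real)" where
  "dist_to_exp X \<phi> = (\<lambda>p\<in>preds X. \<Sum>x\<in>set_pmf \<phi>. pmf \<phi> x * p x)"

definition uf_to_exp :: "'a set \<Rightarrow> 'a set set \<Rightarrow> (('a \<Rightarrow> real) \<Rightarrow> real)" where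
  "uf_to_exp X F = (\<lambda>p\<in>preds X. Inf {s \<in> {0..1}. {x \<in> X. p x \<le> s} \<in> F})"

definition uf_topology :: "'a set \<Rightarrow> ('a set set \<Rightarrow> 'a) \<Rightarrow> 'a topology" where
  "uf_topology X a =
     topology (\<lambda>V. V \<subseteq> X \<and> (\<forall>F\<in>ultrafilters X. X - V \<in> F \<longrightarrow> a F \<in> X - V))"

text \<open>The argument of \<^const>\<open>topology\<close> is a topology for every \<open>a\<close> into \<open>X\<close>, and its closed sets are the
  \<open>U\<close> such that \<open>U \<in> F\<close> implies \<open>a F \<in> U\<close> for all ultrafilters \<open>F\<close>.\<close>

lemma istopology_uf_topology:
  assumes "a \<in> ultrafilters X \<rightarrow> X"
  shows "istopology (\<lambda>V. V \<subseteq> X \<and> (\<forall>F\<in>ultrafilters X. X - V \<in> F \<longrightarrow> a F \<in> X - V))"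
proof -
  have Int: "A \<inter> B \<in> F" if "F \<in> ultrafilters X" "A \<in> F" "B \<in> F" for A B F
    using that by (simp add: ultrafilters_def)
  have up: "B \<in> F" if "F \<in> ultrafilters X" "A \<in> F" "A \<subseteq> B" "B \<subseteq> X" for A B F
    using that by (simp add: ultrafilters_def)
  have compl: "X - A \<in> F" if "F \<in> ultrafilters X" "A \<subseteq> X" "A \<notin> F" for A F
    using that unfolding ultrafilters_def mem_Collect_eq by meson
  have ne: "{} \<notin> F" if "F \<in> ultrafilters X" for F
    using that by (simp add: ultrafilters_def)
  let ?L = "\<lambda>V. V \<subseteq> X \<and> (\<forall>F\<in>ultrafilters X. X - V \<in> F \<longrightarrow> a F \<in> X - V)"
  have inter: "a F \<in> X - S \<inter> T"
    if S: "?L S" and T: "?L T" and F: "F \<in> ultrafilters X" and in_F: "X - S \<inter> T \<in> F" for S T F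
  proof -
    have "X - S \<in> F \<or> X - T \<in> F"
    proof (rule ccontr)
      assume "\<not> (X - S \<in> F \<or> X - T \<in> F)"
      then have "S \<in> F" "T \<in> F" using compl[OF F, of S] compl[OF F, of T] S T by metis+
      then have "(S \<inter> T) \<inter> (X - S \<inter> T) \<in> F" using Int[OF F] in_F by metis
      moreover have "(S \<inter> T) \<inter> (X - S \<inter> T) = {}" by (rule Diff_disjoint)
      ultimately show False using ne[OF F] by metis
    qed
    then show ?thesis
    proof
      assume "X - S \<in> F"
      with S F have "a F \<in> X - S" by metis
      then show ?thesis by simp
    next
      assume "X - T \<in> F"
      with T F have "a F \<in> X - T" by metis
      then show ?thesis by simp
    qed
  qed
  have union: "a F \<in> X - \<Union>K"
    if K: "\<forall>V\<in>K. ?L V" and F: "F \<in> ultrafilters X" and in_F: "X - \<Union>K \<in> F" for K F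
  proof -
    have "a F \<in> X - V" if V: "V \<in> K" for V
    proof -
      have "X - V \<in> F" by (rule up[OF F in_F]) (use V in auto)
      with K F V show ?thesis by metis
    qed
    moreover have "a F \<in> X" using assms F by (rule funcset_mem)
    ultimately show ?thesis by blast
  qed
  define L where "L = ?L"
  have "L (S \<inter> T)" if "L S" "L T" for S T
    using inter[of S T] that unfolding L_def by (metis le_infI1)
  moreover have "L (\<Union>K)" if "\<forall>V\<in>K. L V" for K
    using union[of K] that unfolding L_def by (metis Sup_least)
  ultimately have "istopology L"
    unfolding istopology_def by iprover
  then show ?thesis
    unfolding L_def .
qed

lemma closedin_uf_topology:
  assumes "a \<in> ultrafilters X \<rightarrow> X"
  shows "closedin (uf_topology X a) U \<longleftrightarrow> U \<subseteq> X \<and> (\<forall>F\<in>ultrafilters X. U \<in> F \<longrightarrow> a F \<in> U)"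
proof -
  have op: "openin (uf_topology X a) V \<longleftrightarrow>
    V \<subseteq> X \<and> (\<forall>F\<in>ultrafilters X. X - V \<in> F \<longrightarrow> a F \<in> X - V)" for V
    unfolding uf_topology_def topology_inverse'[OF istopology_uf_topology[OF assms]] ..
  have "openin (uf_topology X a) X"
    unfolding op by (simp add: ultrafilters_def)
  then have "X \<subseteq> topspace (uf_topology X a)" by (rule openin_subset)
  moreover have "topspace (uf_topology X a) \<subseteq> X"
    using op[of "topspace (uf_topology X a)"] by simp
  ultimately have "topspace (uf_topology X a) = X" by simp
  then show ?thesis
    by (simp add: closedin_def op double_diff cong: conj_cong)
qed

definition exp_alg_to_cch :: "'a exp_alg \<Rightarrow> 'a cch" where
  "exp_alg_to_cch A = (let X = acarrier A; \<alpha> = astruct A in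
     \<lparr>ccarrier = X,
      cconv = (\<lambda>\<phi>\<in>Dist X. \<alpha> (dist_to_exp X \<phi>)),
      ctop = uf_topology X (\<lambda>F. \<alpha> (uf_to_exp X F))\<rparr>)"

definition underlying_functor :: "('a exp_alg, 'a \<Rightarrow> 'a, 'a cch, 'a \<Rightarrow> 'a) functor_data" where
  "underlying_functor = \<lparr>fobj = exp_alg_to_cch, farr = (\<lambda>A B f. f)\<rparr>"

definition observable_exp_alg :: "'a exp_alg \<Rightarrow> bool" where
  "observable_exp_alg A \<longleftrightarrow> observable_cch (exp_alg_to_cch A)"

definition Alg_Exp_obs :: "('a exp_alg, 'a \<Rightarrow> 'a) category" where
  "Alg_Exp_obs = full_subcategory Alg_Exp observable_exp_alg"

definition CCH_obs :: "('a cch, 'a \<Rightarrow> 'a) category" where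
  "CCH_obs = full_subcategory CCH observable_cch"

end

theory Submission
  imports Defs
begin

text \<open>
  An element of \<^term>\<open>Exp X\<close> is a finitely additive probability measure on \<open>X\<close>, and rounding
  predicates shows that it is a pointwise limit, along an ultrafilter, of finitely supported
  distributions. The multiplication law makes the structure map \<open>\<alpha>\<close> of an algebra commute with
  such limits. Applied to principal and iterated ultrafilters this gives Manes' theorem that the
  induced topology is compact Hausdorff and that convergence is computed by \<open>\<alpha>\<close>; applied to the
  approximating distributions it shows that affine continuous maps between algebras are
  homomorphisms. For an observable space \<open>Y\<close>, the inverse functor sends \<open>h\<close> to its barycenter, the
  unique point \<open>x\<close> with \<open>q x = h q\<close> for all affine continuous \<open>q\<close> into the unit interval. It exists
  because, by compactness, the barycenters of the approximating distributions have a limit.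
\<close>

section \<open>Ultrafilters as filters\<close>

text \<open>No compatibility between the topology and the convex structure of a space in
  \<open>CCH\<close> is assumed, so a barycenter cannot be found by continuity of
  \<open>cconv\<close>. An affine continuous \<open>q\<close> into [0,1] meets each structure
  separately: it carries \<open>cconv\<close> to a finite weighted sum and topological limits to
  limits of reals. Both become statements about values at the predicate \<open>q\<close>, and
  observability turns equality of all these numbers into equality of points. The equation
  \<open>q x = h q\<close> is not a choice. The interval is itself an algebra, with evaluation at
  the identity predicate as structure map, and \<open>q\<close> is a homomorphism into it; this
  forces the equation in every algebra. Hence an observable space carries at most one algebra
  structure that induces it. On the topological side an algebra provides only a function from
  ultrafilters to points. That this function is convergence for the topology defined by its closed
  sets is the part that needs ultrafilters of ultrafilters.\<close>

definition ultra_on :: "'a set \<Rightarrow> 'a filter \<Rightarrow> bool" where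
  "ultra_on X \<Phi> \<longleftrightarrow> \<Phi> \<noteq> bot \<and> (\<forall>P. eventually P \<Phi> \<or> eventually (\<lambda>x. \<not> P x) \<Phi>) \<and>
     eventually (\<lambda>x. x \<in> X) \<Phi>"

text \<open>Members of \<open>ultrafilters X\<close> are sets of subsets of \<open>X\<close>,
  whereas limits are stated for filters of predicates on the whole type. \<open>ultra_on X\<close>
  describes the second form and \<open>filter_sets X\<close> passes to the first, so that \<tau> can
  be handled with \<open>eventually\<close> and \<open>filtermap\<close>.\<close>

definition filter_sets :: "'a set \<Rightarrow> 'a filter \<Rightarrow> 'a set set" where
  "filter_sets X \<Phi> = {A. A \<subseteq> X \<and> eventually (\<lambda>x. x \<in> A) \<Phi>}"

lemma ultra_on_not_bot: "ultra_on X \<Phi> \<Longrightarrow> \<Phi> \<noteq> bot"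
  by (simp add: ultra_on_def)

lemma ultra_on_carrier: "ultra_on X \<Phi> \<Longrightarrow> eventually (\<lambda>x. x \<in> X) \<Phi>"
  by (simp add: ultra_on_def)

lemma ultra_on_not: "ultra_on X \<Phi> \<Longrightarrow> eventually (\<lambda>x. \<not> P x) \<Phi> \<longleftrightarrow> \<not> eventually P \<Phi>"
proof
  assume "ultra_on X \<Phi>" "eventually (\<lambda>x. \<not> P x) \<Phi>"
  moreover have "eventually (\<lambda>x. False) \<Phi>" if "eventually P \<Phi>" "eventually (\<lambda>x. \<not> P x) \<Phi>"
    using that by eventually_elim simp
  ultimately show "\<not> eventually P \<Phi>" by (auto simp: ultra_on_def trivial_limit_def)
qed (auto simp: ultra_on_def)

lemma ultra_on_filtermap:
  assumes "ultra_on I \<Phi>" and "\<And>i. i \<in> I \<Longrightarrow> f i \<in> X"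
  shows "ultra_on X (filtermap f \<Phi>)"
  using assms unfolding ultra_on_def
  by (auto simp: eventually_filtermap filtermap_bot_iff elim: eventually_mono)

lemma ultra_on_principal: "x \<in> X \<Longrightarrow> ultra_on X (principal {x})"
  by (auto simp: ultra_on_def eventually_principal trivial_limit_def)

lemma filter_sets_ultrafilter:
  assumes "ultra_on X \<Phi>"
  shows "filter_sets X \<Phi> \<in> ultrafilters X"
proof -
  have "eventually (\<lambda>x. x \<in> A) \<Phi> \<or> eventually (\<lambda>x. x \<in> X - A) \<Phi>" for A
  proof (cases "eventually (\<lambda>x. x \<in> A) \<Phi>")
    case False
    then have "eventually (\<lambda>x. x \<notin> A) \<Phi>" using ultra_on_not[OF assms] by blast
    then have "eventually (\<lambda>x. x \<in> X - A) \<Phi>"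
      using ultra_on_carrier[OF assms] by eventually_elim simp
    then show ?thesis ..
  qed simp
  moreover have "\<not> eventually (\<lambda>x. x \<in> {}) \<Phi>"
    using assms by (simp add: ultra_on_def trivial_limit_def)
  moreover have "eventually (\<lambda>x. x \<in> B) \<Phi>" if "A \<subseteq> B" "eventually (\<lambda>x. x \<in> A) \<Phi>" for A B
    using that by (auto elim: eventually_mono)
  moreover have "eventually (\<lambda>x. x \<in> A \<inter> B) \<Phi>"
    if "eventually (\<lambda>x. x \<in> A) \<Phi>" "eventually (\<lambda>x. x \<in> B) \<Phi>" for A B
    using that by (simp add: eventually_conj)
  moreover have "eventually (\<lambda>x. x \<in> X) \<Phi>"
    using assms by (rule ultra_on_carrier)
  ultimately show ?thesis
    unfolding ultrafilters_def filter_sets_def by blast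
qed

lemma ultrafilter_eq_filter_sets:
  assumes F: "F \<in> ultrafilters X"
  obtains \<Phi> where "ultra_on X \<Phi>" "F = filter_sets X \<Phi>"
proof -
  \<comment> \<open>A predicate on the whole type is judged by its trace on
    \<open>X\<close>.\<close>
  define \<Phi> where "\<Phi> = Abs_filter (\<lambda>P. {x \<in> X. P x} \<in> F)"
  have sub: "A \<subseteq> X" if "A \<in> F" for A using F that by (auto simp: ultrafilters_def)
  have int: "A \<inter> B \<in> F" if "A \<in> F" "B \<in> F" for A B using F that by (simp add: ultrafilters_def)
  have up: "B \<in> F" if "A \<in> F" "A \<subseteq> B" "B \<subseteq> X" for A B using F that by (simp add: ultrafilters_def)
  have top: "X \<in> F" and ne: "{} \<notin> F" using F by (simp_all add: ultrafilters_def)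
  have dich: "A \<in> F \<or> X - A \<in> F" if "A \<subseteq> X" for A using F that by (simp add: ultrafilters_def)
  have "is_filter (\<lambda>P. {x \<in> X. P x} \<in> F)"
  proof
    show "{x \<in> X. True} \<in> F" using top by simp
  next
    fix P Q assume "{x \<in> X. P x} \<in> F" "{x \<in> X. Q x} \<in> F"
    from int[OF this] show "{x \<in> X. P x \<and> Q x} \<in> F" by (rule up) auto
  next
    fix P Q :: "'a \<Rightarrow> bool" assume "\<forall>x. P x \<longrightarrow> Q x" "{x \<in> X. P x} \<in> F"
    then show "{x \<in> X. Q x} \<in> F" by (auto intro: up)
  qed
  then have ev: "eventually P \<Phi> \<longleftrightarrow> {x \<in> X. P x} \<in> F" for P
    unfolding \<Phi>_def by (rule eventually_Abs_filter)
  have "eventually P \<Phi> \<or> eventually (\<lambda>x. \<not> P x) \<Phi>" for P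
  proof -
    have "X - {x \<in> X. P x} = {x \<in> X. \<not> P x}" by auto
    with dich[of "{x \<in> X. P x}"] show ?thesis by (auto simp: ev)
  qed
  moreover have "\<Phi> \<noteq> bot" using ne by (auto simp: trivial_limit_def ev)
  moreover have "eventually (\<lambda>x. x \<in> X) \<Phi>" using top by (simp add: ev)
  ultimately have "ultra_on X \<Phi>" by (simp add: ultra_on_def)
  moreover have "F = filter_sets X \<Phi>"
  proof -
    have "A \<in> F \<longleftrightarrow> A \<in> filter_sets X \<Phi>" for A
    proof (cases "A \<subseteq> X")
      case True
      then have "{x \<in> X. x \<in> A} = A" by auto
      then show ?thesis using True by (simp add: filter_sets_def ev)
    qed (use sub in \<open>auto simp: filter_sets_def\<close>)
    then show ?thesis by (rule set_eqI)
  qed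
  ultimately show thesis by (rule that)
qed

section \<open>Existence, sums and maximality of ultrafilters\<close>

text \<open>Zorn's lemma for the reversed order: a minimal proper filter below \<Psi> is an
  ultrafilter. Adding \<open>P\<close> to it either gives the improper filter, and then the negation
  of \<open>P\<close> already holds, or gives back the same filter by minimality.\<close>

lemma ex_ultra_on:
  assumes "\<Psi> \<noteq> bot" and X: "eventually (\<lambda>x. x \<in> X) \<Psi>"
  obtains \<Phi> where "\<Phi> \<le> \<Psi>" "ultra_on X \<Phi>"
proof -
  define A where "A = {\<Phi>. \<Phi> \<noteq> bot \<and> \<Phi> \<le> \<Psi>}"
  have "\<exists>m\<in>A. \<forall>a\<in>A. m \<ge> a \<longrightarrow> a = m"
  proof (rule predicate_Zorn)
    show "partial_order_on A (relation_of (\<ge>) A)"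
      by (rule partial_order_on_relation_ofI) auto
  next
    fix C assume "C \<in> Chains (relation_of (\<ge>) A)"
    then have sub: "C \<subseteq> A" and ch: "a \<le> b \<or> b \<le> a" if "a \<in> C" "b \<in> C" for a b
      using that by (auto simp: Chains_def relation_of_def)
    show "\<exists>u\<in>A. \<forall>a\<in>C. a \<ge> u"
    proof (cases "C = {}")
      case True
      then show ?thesis using assms by (auto simp: A_def)
    next
      case False
      have sub: "C \<subseteq> A"
        using \<open>C \<in> Chains (relation_of (\<ge>) A)\<close> by (auto simp: Chains_def relation_of_def)
      \<comment> \<open>A chain of filters is directed, so what holds in the infimum already holds
        in one member; this keeps the infimum proper.\<close>
      have "eventually P (Inf C) \<longleftrightarrow> (\<exists>b\<in>C. eventually P b)" for P
        by (rule eventually_Inf_base[OF False]) (metis ch inf.absorb1 inf.absorb2 order_refl)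
      then have "Inf C \<noteq> bot"
        using sub by (auto simp: trivial_limit_def A_def)
      moreover have "Inf C \<le> \<Psi>"
        using False sub by (auto simp: A_def intro: Inf_lower2)
      ultimately show ?thesis
        by (intro bexI[of _ "Inf C"]) (auto simp: A_def Inf_lower)
    qed
  qed
  then obtain \<Phi> where \<Phi>: "\<Phi> \<noteq> bot" "\<Phi> \<le> \<Psi>"
    and min: "\<And>a. a \<noteq> bot \<Longrightarrow> a \<le> \<Psi> \<Longrightarrow> a \<le> \<Phi> \<Longrightarrow> a = \<Phi>"
    by (auto simp: A_def)
  have "eventually P \<Phi> \<or> eventually (\<lambda>x. \<not> P x) \<Phi>" for P
  proof (cases "inf \<Phi> (principal {x. P x}) = bot")
    case True
    then have "eventually (\<lambda>x. \<not> P x) \<Phi>"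
      by (simp add: trivial_limit_def eventually_inf_principal)
    then show ?thesis ..
  next
    case False
    then have "inf \<Phi> (principal {x. P x}) = \<Phi>"
      using \<Phi>(2) by (intro min) (auto intro: le_infI1)
    moreover have "eventually P (inf \<Phi> (principal {x. P x}))"
      by (simp add: eventually_inf_principal)
    ultimately show ?thesis by simp
  qed
  with \<Phi> X have "ultra_on X \<Phi>" by (auto simp: ultra_on_def elim: filter_leD)
  with \<Phi>(2) show thesis by (rule that)
qed

text \<open>Finite intersection property: the filter generated by the conditions is proper, hence
  refined by an ultrafilter. The conditions will be closed sets, pairs of a predicate and a
  tolerance, and inclusions between sets.\<close>

lemma ex_ultra_on_INF:
  fixes I :: "'i set" and X :: "'a set"
  assumes ne: "\<And>J. finite J \<Longrightarrow> J \<subseteq> I \<Longrightarrow> \<exists>x\<in>X. \<forall>i\<in>J. P i x"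
  obtains \<Phi> where "ultra_on X \<Phi>" "\<And>i. i \<in> I \<Longrightarrow> eventually (P i) \<Phi>"
proof -
  define \<Psi> where "\<Psi> = (INF i\<in>I. principal {x \<in> X. P i x})"
  \<comment> \<open>The extra index \<open>None\<close> turns the carrier \<open>X\<close> into one
    more generator, so that a single argument about finite subfamilies proves properness.\<close>
  have "inf \<Psi> (principal X) = (INF i\<in>insert None (Some ` I).
    principal (case i of None \<Rightarrow> X | Some i \<Rightarrow> {x \<in> X. P i x}))"
    by (simp add: \<Psi>_def inf.commute image_image)
  also have "\<dots> \<noteq> bot"
  proof (rule INF_filter_not_bot)
    fix J :: "'i option set" assume J: "J \<subseteq> insert None (Some ` I)" "finite J"
    have "finite {i. Some i \<in> J}" using J(2) by (rule finite_vimageI[of J Some, unfolded vimage_def]) simp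
    moreover have "{i. Some i \<in> J} \<subseteq> I" using J(1) by auto
    ultimately obtain x where "x \<in> X" "\<forall>i\<in>{i. Some i \<in> J}. P i x" using ne by blast
    then have "x \<in> (\<Inter>i\<in>J. case i of None \<Rightarrow> X | Some i \<Rightarrow> {x \<in> X. P i x})"
      by (auto split: option.split)
    then show "(INF i\<in>J. principal (case i of None \<Rightarrow> X | Some i \<Rightarrow> {x \<in> X. P i x})) \<noteq> bot"
      unfolding INF_principal_finite[OF J(2)] principal_eq_bot_iff by blast
  qed
  finally have "inf \<Psi> (principal X) \<noteq> bot" .
  moreover have "eventually (\<lambda>x. x \<in> X) (inf \<Psi> (principal X))"
    by (simp add: eventually_inf_principal)
  ultimately obtain \<Phi> where \<Phi>: "\<Phi> \<le> inf \<Psi> (principal X)" "ultra_on X \<Phi>"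
    by (rule ex_ultra_on)
  have "eventually (P i) \<Phi>" if "i \<in> I" for i
  proof (rule filter_leD)
    show "\<Phi> \<le> principal {x \<in> X. P i x}"
      using \<Phi>(1) that unfolding \<Psi>_def by (meson INF_lower le_inf_iff order_trans)
  qed (simp add: eventually_principal)
  with \<Phi>(2) show thesis by (rule that)
qed

text \<open>This is the multiplication of the ultrafilter monad applied to the image of
  \<open>G\<close> under \<open>F\<close>. As \<open>F i\<close> is an ultrafilter only for
  \<open>i\<close> in \<open>I\<close>, the arguments are intersected with the event that
  \<open>i\<close> lies in \<open>I\<close>.\<close>

lemma ex_ultra_filter_sum:
  assumes G: "ultra_on I G" and F: "\<And>i. i \<in> I \<Longrightarrow> ultra_on X (F i)"
  obtains \<Phi> where "ultra_on X \<Phi>"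
    "\<And>P. eventually P \<Phi> \<longleftrightarrow> eventually (\<lambda>i. eventually P (F i)) G"
proof -
  let ?S = "\<lambda>P. eventually (\<lambda>i. eventually P (F i)) G"
  have "is_filter ?S"
  proof
    fix P Q assume "?S P" "?S Q"
    then show "?S (\<lambda>x. P x \<and> Q x)" by eventually_elim (rule eventually_conj)
  next
    fix P Q assume "\<forall>x. P x \<longrightarrow> Q x" "?S P"
    then show "?S Q" by (auto elim!: eventually_mono)
  qed simp
  then have ev: "eventually P (Abs_filter ?S) \<longleftrightarrow> ?S P" for P
    by (rule eventually_Abs_filter)
  have I: "eventually (\<lambda>i. i \<in> I) G" using G by (rule ultra_on_carrier)
  have "?S P \<or> ?S (\<lambda>x. \<not> P x)" for P
  proof (cases "?S P")
    case False
    then have "eventually (\<lambda>i. \<not> eventually P (F i)) G" by (simp add: ultra_on_not[OF G])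
    then have "?S (\<lambda>x. \<not> P x)" using I by eventually_elim (simp add: ultra_on_not[OF F])
    then show ?thesis ..
  qed simp
  moreover have "\<not> ?S (\<lambda>x. False)"
  proof
    assume "?S (\<lambda>x. False)"
    then have "eventually (\<lambda>i. False) G"
      using I by eventually_elim (use F ultra_on_not_bot in \<open>auto simp: trivial_limit_def\<close>)
    then show False using ultra_on_not_bot[OF G] by (simp add: trivial_limit_def)
  qed
  moreover have "?S (\<lambda>x. x \<in> X)"
    using I by eventually_elim (rule ultra_on_carrier[OF F])
  ultimately have "ultra_on X (Abs_filter ?S)"
    by (simp add: ultra_on_def ev trivial_limit_def)
  with ev show thesis using that by blast
qed

text \<open>Maximality of ultrafilters: if \<open>P\<close> held in \<Theta> but not in \<Phi>, its
  negation would pass from \<Phi> to \<Theta>.\<close>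

lemma ultra_on_le_imp_eq:
  assumes \<Phi>: "ultra_on X \<Phi>" and \<Theta>: "ultra_on Y \<Theta>" and le: "\<And>P. eventually P \<Phi> \<Longrightarrow> eventually P \<Theta>"
  shows "\<Theta> = \<Phi>"
  unfolding filter_eq_iff
proof (intro allI iffI)
  fix P assume P: "eventually P \<Theta>"
  show "eventually P \<Phi>"
  proof (rule ccontr)
    assume "\<not> eventually P \<Phi>"
    then have "eventually (\<lambda>x. \<not> P x) \<Theta>" using ultra_on_not[OF \<Phi>] le by blast
    then show False using P ultra_on_not[OF \<Theta>] by blast
  qed
qed (rule le)

lemma filtermap_eventually_const:
  assumes "G \<noteq> bot" and ev: "eventually (\<lambda>i. f i = x) G"
  shows "filtermap f G = principal {x}"
  unfolding filter_eq_iff eventually_filtermap eventually_principal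
proof (intro allI iffI ballI)
  fix P y assume "eventually (\<lambda>i. P (f i)) G" "y \<in> {x}"
  then have "\<exists>i. P (f i) \<and> f i = x"
    using eventually_conj[OF _ ev] eventually_happens'[OF assms(1)] by blast
  then show "P y" using \<open>y \<in> {x}\<close> by auto
next
  fix P assume "\<forall>y\<in>{x}. P y"
  with ev show "eventually (\<lambda>i. P (f i)) G" by (auto elim: eventually_mono)
qed

lemma filtermap_eventually_cong:
  fixes f g :: "'a \<Rightarrow> 'b"
  assumes "eventually (\<lambda>x. f x = g x) F"
  shows "filtermap f F = filtermap g F"
  unfolding filter_eq_iff eventually_filtermap
proof
  fix P :: "'b \<Rightarrow> bool"
  have "eventually (\<lambda>x. P (f x) = P (g x)) F" using assms by (rule eventually_mono) simp
  then show "eventually (\<lambda>x. P (f x)) F \<longleftrightarrow> eventually (\<lambda>x. P (g x)) F" by (rule eventually_subst)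
qed

lemma filtermap_eventually_ident:
  assumes ev: "eventually (\<lambda>i. f i = i) G"
  shows "filtermap f G = G"
  using filtermap_eventually_cong[OF ev] by (simp add: filtermap_ident)

section \<open>Ultrafilter convergence in topological spaces\<close>

text \<open>The closed sets belonging to \<Phi> have the finite intersection property, and a point
  \<open>l\<close> in all of them is a limit: if an open set around \<open>l\<close> were not in
  \<Phi>, its complement would be such a closed set and would contain \<open>l\<close>.\<close>

lemma compact_space_ultra_limit:
  assumes T: "compact_space T" and \<Phi>: "ultra_on (topspace T) \<Phi>"
  obtains l where "limitin T (\<lambda>x. x) l \<Phi>"
proof -
  let ?U = "{C. closedin T C \<and> eventually (\<lambda>x. x \<in> C) \<Phi>}"
  have ne: "\<Inter>\<F> \<noteq> {}" if "finite \<F>" "\<F> \<subseteq> ?U" for \<F>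
  proof -
    have "eventually (\<lambda>x. \<forall>C\<in>\<F>. x \<in> C) \<Phi>"
      using that by (intro eventually_ball_finite) auto
    then have "\<exists>x. \<forall>C\<in>\<F>. x \<in> C"
      using ultra_on_not_bot[OF \<Phi>] eventually_happens by blast
    then show ?thesis by auto
  qed
  have "\<Inter>?U \<noteq> {}"
  proof (rule T[unfolded compact_space_fip, THEN spec, THEN mp], intro conjI ballI allI impI)
    show "closedin T C" if "C \<in> ?U" for C using that by simp
    show "\<Inter>\<F> \<noteq> {}" if "finite \<F> \<and> \<F> \<subseteq> ?U" for \<F>
      using ne that by iprover
  qed
  then obtain l where "l \<in> \<Inter>?U" by (elim ex_in_conv[THEN iffD2, THEN exE])
  then have l: "l \<in> C" if "closedin T C" "eventually (\<lambda>x. x \<in> C) \<Phi>" for C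
    using that by simp
  have "limitin T (\<lambda>x. x) l \<Phi>"
    unfolding limitin_def
  proof (intro conjI allI impI)
    show "l \<in> topspace T" using ultra_on_carrier[OF \<Phi>] by (intro l) auto
  next
    fix U assume U: "openin T U \<and> l \<in> U"
    show "eventually (\<lambda>x. x \<in> U) \<Phi>"
    proof (rule ccontr)
      assume "\<not> eventually (\<lambda>x. x \<in> U) \<Phi>"
      then have "eventually (\<lambda>x. x \<notin> U) \<Phi>" using ultra_on_not[OF \<Phi>] by blast
      then have "eventually (\<lambda>x. x \<in> topspace T - U) \<Phi>"
        using ultra_on_carrier[OF \<Phi>] by eventually_elim simp
      then have "l \<in> topspace T - U" using U by (intro l) auto
      then show False using U by simp
    qed
  qed
  then show thesis by (rule that)
qed

lemma limitin_iff_le_nhdsin: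
  "limitin T (\<lambda>x. x) l \<Phi> \<longleftrightarrow> l \<in> topspace T \<and> \<Phi> \<le> nhdsin T l"
  unfolding limitin_def le_filter_def eventually_nhdsin
proof (intro conj_cong refl iffI allI impI)
  fix P assume l: "l \<in> topspace T" and ev: "\<forall>U. openin T U \<and> l \<in> U \<longrightarrow> eventually (\<lambda>x. x \<in> U) \<Phi>"
    and "l \<notin> topspace T \<or> (\<exists>S. openin T S \<and> l \<in> S \<and> (\<forall>x\<in>S. P x))"
  then obtain S where "openin T S" "l \<in> S" and S: "\<forall>x\<in>S. P x" by blast
  then have "eventually (\<lambda>x. x \<in> S) \<Phi>" using ev by blast
  then show "eventually P \<Phi>" by (rule eventually_mono) (use S in blast)
next
  fix U assume ev: "\<forall>P. l \<notin> topspace T \<or> (\<exists>S. openin T S \<and> l \<in> S \<and> (\<forall>x\<in>S. P x)) \<longrightarrow> eventually P \<Phi>"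
    and U: "openin T U \<and> l \<in> U"
  show "eventually (\<lambda>x. x \<in> U) \<Phi>" by (rule ev[rule_format]) (use U in blast)
qed

lemma limitin_filtermap_ident: "limitin T (\<lambda>x. x) l (filtermap f F) \<longleftrightarrow> limitin T f l F"
  by (simp add: limitin_def eventually_filtermap)

text \<open>If two points have no disjoint neighbourhoods, the infimum of their neighbourhood
  filters is proper, and an ultrafilter below it converges to both.\<close>

lemma Hausdorff_space_ultraI:
  assumes unique: "\<And>\<Phi> x y. ultra_on (topspace T) \<Phi> \<Longrightarrow> limitin T (\<lambda>x. x) x \<Phi> \<Longrightarrow>
    limitin T (\<lambda>x. x) y \<Phi> \<Longrightarrow> x = y"
  shows "Hausdorff_space T"
  unfolding Hausdorff_space_def
proof (intro allI impI, elim conjE)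
  fix x y assume x: "x \<in> topspace T" and y: "y \<in> topspace T" and "x \<noteq> y"
  have "inf (nhdsin T x) (nhdsin T y) = bot"
  proof (rule ccontr)
    assume ne: "inf (nhdsin T x) (nhdsin T y) \<noteq> bot"
    have "eventually (\<lambda>z. z \<in> topspace T) (nhdsin T x)"
      using x by (auto simp: eventually_nhdsin)
    then have "eventually (\<lambda>z. z \<in> topspace T) (inf (nhdsin T x) (nhdsin T y))"
      by (rule filter_leD[OF inf_le1])
    with ne obtain \<Phi> where \<Phi>: "\<Phi> \<le> inf (nhdsin T x) (nhdsin T y)" "ultra_on (topspace T) \<Phi>"
      by (rule ex_ultra_on)
    from \<Phi>(1) have "limitin T (\<lambda>x. x) x \<Phi>" "limitin T (\<lambda>x. x) y \<Phi>"
      using x y by (simp_all add: limitin_iff_le_nhdsin)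
    with unique[OF \<Phi>(2)] \<open>x \<noteq> y\<close> show False by blast
  qed
  then have "eventually (\<lambda>z. False) (inf (nhdsin T x) (nhdsin T y))" by (simp add: trivial_limit_def)
  then obtain P Q where "eventually P (nhdsin T x)" "eventually Q (nhdsin T y)"
    and PQ: "\<And>z. P z \<Longrightarrow> Q z \<Longrightarrow> False"
    unfolding eventually_inf by blast
  then obtain U V where "openin T U" "x \<in> U" "\<forall>z\<in>U. P z" "openin T V" "y \<in> V" "\<forall>z\<in>V. Q z"
    unfolding eventually_nhdsin using x y by blast
  with PQ show "\<exists>U V. openin T U \<and> openin T V \<and> x \<in> U \<and> y \<in> V \<and> disjnt U V"
    unfolding disjnt_iff by blast
qed

text \<open>Closed sets with the finite intersection property lie together in one ultrafilter, and a
  limit of it cannot leave any of them.\<close>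

lemma compact_space_ultraI:
  assumes conv: "\<And>\<Phi>. ultra_on (topspace T) \<Phi> \<Longrightarrow> \<exists>l. limitin T (\<lambda>x. x) l \<Phi>"
  shows "compact_space T"
  unfolding compact_space_fip
proof (intro allI impI, elim conjE)
  fix \<U> assume cl: "\<forall>C\<in>\<U>. closedin T C"
    and fip: "\<forall>\<F>. finite \<F> \<and> \<F> \<subseteq> \<U> \<longrightarrow> \<Inter>\<F> \<noteq> {}"
  show "\<Inter>\<U> \<noteq> {}"
  proof (cases "\<U> = {}")
    case False
    then obtain C0 where C0: "C0 \<in> \<U>" by blast
    have "\<exists>x\<in>topspace T. \<forall>C\<in>J. x \<in> C" if J: "finite J" "J \<subseteq> \<U>" for J
    proof -
      \<comment> \<open>Adjoining \<open>C0\<close> keeps the witness inside the space even for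
        empty \<open>J\<close>, whose intersection is the whole type.\<close>
      have "\<Inter>(insert C0 J) \<noteq> {}" using J C0 by (intro fip[rule_format]) simp
      then obtain x where "x \<in> C0" "\<forall>C\<in>J. x \<in> C" by auto
      moreover have "C0 \<subseteq> topspace T" using cl C0 closedin_subset by blast
      ultimately show ?thesis by blast
    qed
    then obtain \<Phi> where \<Phi>: "ultra_on (topspace T) \<Phi>" and ev: "\<And>C. C \<in> \<U> \<Longrightarrow> eventually (\<lambda>x. x \<in> C) \<Phi>"
      by (rule ex_ultra_on_INF[where P="\<lambda>C x. x \<in> C" and I="\<U>" and X="topspace T"]) iprover+
    obtain l where l: "limitin T (\<lambda>x. x) l \<Phi>" using conv[OF \<Phi>] by blast
    have "l \<in> C" if C: "C \<in> \<U>" for C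
    proof (rule ccontr)
      assume "l \<notin> C"
      then have "eventually (\<lambda>x. x \<in> topspace T - C) \<Phi>"
        using l cl C unfolding limitin_def by blast
      with ev[OF C] have "eventually (\<lambda>x. False) \<Phi>" by eventually_elim simp
      then show False using ultra_on_not_bot[OF \<Phi>] by (simp add: trivial_limit_def)
    qed
    then show ?thesis by blast
  qed simp
qed

section \<open>Topologies determined by ultrafilter limits\<close>

lemma topspace_uf_topology:
  assumes "a \<in> ultrafilters X \<rightarrow> X"
  shows "topspace (uf_topology X a) = X"
proof
  show "topspace (uf_topology X a) \<subseteq> X"
    using closedin_topspace closedin_uf_topology[OF assms] by blast
  have "closedin (uf_topology X a) X"
    using closedin_uf_topology[OF assms] funcset_mem[OF assms] by blast
  then show "X \<subseteq> topspace (uf_topology X a)" by (rule closedin_subset)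
qed

lemma closedin_uf_topology_ultra:
  assumes "a \<in> ultrafilters X \<rightarrow> X"
  shows "closedin (uf_topology X a) U \<longleftrightarrow> U \<subseteq> X \<and>
    (\<forall>\<Phi>. ultra_on X \<Phi> \<and> eventually (\<lambda>x. x \<in> U) \<Phi> \<longrightarrow> a (filter_sets X \<Phi>) \<in> U)"
  unfolding closedin_uf_topology[OF assms]
proof (intro conj_cong refl iffI ballI allI impI)
  fix \<Phi> assume "U \<subseteq> X" "\<forall>F\<in>ultrafilters X. U \<in> F \<longrightarrow> a F \<in> U"
    "ultra_on X \<Phi> \<and> eventually (\<lambda>x. x \<in> U) \<Phi>"
  then show "a (filter_sets X \<Phi>) \<in> U"
    using filter_sets_ultrafilter[of X \<Phi>] by (simp add: filter_sets_def)
next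
  fix F assume *: "\<forall>\<Phi>. ultra_on X \<Phi> \<and> eventually (\<lambda>x. x \<in> U) \<Phi> \<longrightarrow> a (filter_sets X \<Phi>) \<in> U"
    and F: "F \<in> ultrafilters X" "U \<in> F"
  obtain \<Phi> where "ultra_on X \<Phi>" "F = filter_sets X \<Phi>"
    using F(1) by (rule ultrafilter_eq_filter_sets)
  with * F(2) show "a F \<in> U" by (simp add: filter_sets_def)
qed

text \<open>Identifies the induced topology both for [0,1] and for an observable space. Limits of
  ultrafilters on a closed set stay in it; conversely every closure point of \<open>U\<close> is the
  limit of an ultrafilter containing \<open>U\<close>, and the Hausdorff property makes this the
  value prescribed by \<open>a\<close>.\<close>

lemma uf_topology_eq:
  assumes T: "Hausdorff_space T"
    and lim: "\<And>\<Phi>. ultra_on (topspace T) \<Phi> \<Longrightarrow> limitin T (\<lambda>x. x) (a (filter_sets (topspace T) \<Phi>)) \<Phi>"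
  shows "uf_topology (topspace T) a = T"
proof -
  let ?X = "topspace T"
  have a: "a \<in> ultrafilters ?X \<rightarrow> ?X"
  proof
    fix F assume "F \<in> ultrafilters ?X"
    then obtain \<Phi> where "ultra_on ?X \<Phi>" "F = filter_sets ?X \<Phi>" by (rule ultrafilter_eq_filter_sets)
    then show "a F \<in> ?X" using lim limitin_topspace by metis
  qed
  have "closedin (uf_topology ?X a) U \<longleftrightarrow> closedin T U" for U
    unfolding closedin_uf_topology_ultra[OF a]
  proof (intro iffI conjI allI impI, elim conjE)
    fix \<Phi> assume U: "closedin T U" and \<Phi>: "ultra_on ?X \<Phi> \<and> eventually (\<lambda>x. x \<in> U) \<Phi>"
    have l: "limitin T (\<lambda>x. x) (a (filter_sets ?X \<Phi>)) \<Phi>" using lim \<Phi> by blast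
    show "a (filter_sets ?X \<Phi>) \<in> U"
    proof (rule ccontr)
      assume "a (filter_sets ?X \<Phi>) \<notin> U"
      then have "eventually (\<lambda>x. x \<in> ?X - U) \<Phi>"
        using l U unfolding limitin_def by blast
      then have "eventually (\<lambda>x. False) \<Phi>" using conjunct2[OF \<Phi>] by eventually_elim simp
      then show False using \<Phi> ultra_on_not_bot by (auto simp: trivial_limit_def)
    qed
  next
    assume U: "U \<subseteq> ?X"
      and cl: "\<forall>\<Phi>. ultra_on ?X \<Phi> \<and> eventually (\<lambda>x. x \<in> U) \<Phi> \<longrightarrow> a (filter_sets ?X \<Phi>) \<in> U"
    have "T closure_of U \<subseteq> U"
    proof
      fix x assume x: "x \<in> T closure_of U"
      then have xX: "x \<in> ?X" by (simp add: in_closure_of)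
      have "inf (nhdsin T x) (principal U) \<noteq> bot"
      proof
        assume "inf (nhdsin T x) (principal U) = bot"
        then have "eventually (\<lambda>z. z \<notin> U) (nhdsin T x)"
          by (simp add: trivial_limit_def eventually_inf_principal)
        then show False using x xX by (auto simp: eventually_nhdsin in_closure_of)
      qed
      moreover have "eventually (\<lambda>z. z \<in> ?X) (inf (nhdsin T x) (principal U))"
        using xX by (intro filter_leD[OF inf_le1]) (auto simp: eventually_nhdsin)
      ultimately obtain \<Phi> where \<Phi>: "\<Phi> \<le> inf (nhdsin T x) (principal U)" "ultra_on ?X \<Phi>"
        by (rule ex_ultra_on)
      have "eventually (\<lambda>z. z \<in> U) \<Phi>"
        using \<Phi>(1) by (auto simp: le_principal)
      with cl \<Phi>(2) have "a (filter_sets ?X \<Phi>) \<in> U" by blast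
      moreover have "limitin T (\<lambda>x. x) x \<Phi>"
        using xX \<Phi>(1) by (simp add: limitin_iff_le_nhdsin)
      then have "x = a (filter_sets ?X \<Phi>)"
        by (rule limitin_Hausdorff_unique[OF _ lim[OF \<Phi>(2)] ultra_on_not_bot[OF \<Phi>(2)] T])
      ultimately show "x \<in> U" by simp
    qed
    then show "closedin T U"
      using U by (simp add: closure_of_subset_eq[symmetric])
  qed (use closedin_subset in blast)
  then show ?thesis
    unfolding topology_eq openin_closedin_eq topspace_uf_topology[OF a] by simp
qed

section \<open>The expectation monad\<close>

lemma predsD: "p \<in> preds X \<Longrightarrow> x \<in> X \<Longrightarrow> 0 \<le> p x \<and> p x \<le> (1::real)"
  by (auto dest: PiE_mem)

lemma preds_eqI: "p \<in> preds X \<Longrightarrow> q \<in> preds X \<Longrightarrow> (\<And>x. x \<in> X \<Longrightarrow> p x = q x) \<Longrightarrow> p = q"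
  by (rule PiE_ext)

lemma preds_compose: "p \<in> preds Y \<Longrightarrow> (\<And>x. x \<in> X \<Longrightarrow> f x \<in> Y) \<Longrightarrow> (\<lambda>x\<in>X. p (f x)) \<in> preds X"
  by (auto dest: predsD)

lemma preds_one: "(\<lambda>x\<in>X. 1) \<in> preds X"
  by auto

lemma preds_add:
  "p \<in> preds X \<Longrightarrow> q \<in> preds X \<Longrightarrow> \<forall>x\<in>X. p x + q x \<le> 1 \<Longrightarrow> (\<lambda>x\<in>X. p x + q x) \<in> preds X"
  using predsD[of p X] predsD[of q X] by (auto intro!: add_nonneg_nonneg)

lemma preds_scale:
  "r \<in> {0..1} \<Longrightarrow> p \<in> preds X \<Longrightarrow> (\<lambda>x\<in>X. r * p x) \<in> preds X"
  using predsD[of p X] by (auto intro!: mult_le_one)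

text \<open>Translates the effect module records into real arithmetic. From right to left the sum
  \<open>h p + h q\<close> must be shown to be defined in [0,1]; it is, being the value of
  \<open>h\<close> at a predicate.\<close>

lemma Exp_iff:
  "h \<in> Exp X \<longleftrightarrow> h \<in> preds X \<rightarrow>\<^sub>E {0..1} \<and> h (\<lambda>x\<in>X. 1) = 1 \<and>
     (\<forall>p\<in>preds X. \<forall>q\<in>preds X. (\<forall>x\<in>X. p x + q x \<le> 1) \<longrightarrow> h (\<lambda>x\<in>X. p x + q x) = h p + h q) \<and>
     (\<forall>r\<in>{0..1}. \<forall>p\<in>preds X. h (\<lambda>x\<in>X. r * p x) = r * h p)"
proof -
  have one: "eone (pred_emod X) = (\<lambda>x\<in>X. 1)" "eone unit_emod = 1"
    by (auto simp: eone_def pred_emod_def unit_emod_def)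
  have *: "(\<forall>z. eplus (pred_emod X) p q = Some z \<longrightarrow> eplus unit_emod (h p) (h q) = Some (h z)) \<longleftrightarrow>
    ((\<forall>x\<in>X. p x + q x \<le> 1) \<longrightarrow> h (\<lambda>x\<in>X. p x + q x) = h p + h q)"
    if "h \<in> preds X \<rightarrow>\<^sub>E {0..1}" "p \<in> preds X" "q \<in> preds X" for p q
  proof -
    have "h (\<lambda>x\<in>X. p x + q x) \<le> 1" if "\<forall>x\<in>X. p x + q x \<le> 1"
    proof -
      have "(\<lambda>x\<in>X. p x + q x) \<in> preds X"
        using that \<open>p \<in> preds X\<close> \<open>q \<in> preds X\<close>
        by (auto dest: predsD intro!: add_nonneg_nonneg)
      then show ?thesis using PiE_mem[OF \<open>h \<in> preds X \<rightarrow>\<^sub>E {0..1}\<close>] by simp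
    qed
    then show ?thesis by (auto simp: pred_emod_def unit_emod_def)
  qed
  have c: "ecarrier (pred_emod X) = preds X" "ecarrier unit_emod = {0..1}"
    "escale (pred_emod X) = (\<lambda>r p. \<lambda>x\<in>X. r * p x)" "escale unit_emod = (*)"
    by (auto simp: pred_emod_def unit_emod_def)
  show ?thesis
    unfolding Exp_def emod_hom_def mem_Collect_eq one c
    by (intro conj_cong refl ball_cong) (rule *)
qed

section \<open>Order and distance estimates for a single expectation\<close>

context
  fixes h :: "('a \<Rightarrow> real) \<Rightarrow> real" and X :: "'a set"
  assumes h: "h \<in> Exp X"
begin

lemma Exp_range: "p \<in> preds X \<Longrightarrow> 0 \<le> h p \<and> h p \<le> 1"
  using h unfolding Exp_iff by (auto dest: PiE_mem)

lemma Exp_one: "h (\<lambda>x\<in>X. 1) = 1"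
  using h unfolding Exp_iff by blast

lemma Exp_add:
  "p \<in> preds X \<Longrightarrow> q \<in> preds X \<Longrightarrow> (\<And>x. x \<in> X \<Longrightarrow> p x + q x \<le> 1) \<Longrightarrow>
    h (\<lambda>x\<in>X. p x + q x) = h p + h q"
  using h unfolding Exp_iff by blast

lemma Exp_scale: "0 \<le> r \<Longrightarrow> r \<le> 1 \<Longrightarrow> p \<in> preds X \<Longrightarrow> h (\<lambda>x\<in>X. r * p x) = r * h p"
  using h unfolding Exp_iff by auto

lemma Exp_zero: "h (\<lambda>x\<in>X. 0) = 0"
  using Exp_scale[of 0 "\<lambda>x\<in>X. 1"] by (simp cong: restrict_cong)

lemma Exp_const: "0 \<le> r \<Longrightarrow> r \<le> 1 \<Longrightarrow> h (\<lambda>x\<in>X. r) = r"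
  using Exp_scale[of r "\<lambda>x\<in>X. 1"] by (simp add: Exp_one cong: restrict_cong)

text \<open>The difference \<open>q - p\<close> is again a predicate, so \<open>h q\<close> is
  \<open>h p\<close> plus a nonnegative number.\<close>

lemma Exp_mono:
  assumes p: "p \<in> preds X" and q: "q \<in> preds X" and le: "\<And>x. x \<in> X \<Longrightarrow> p x \<le> q x"
  shows "h p \<le> h q"
proof -
  have d: "(\<lambda>x\<in>X. q x - p x) \<in> preds X"
    using le predsD[OF p] predsD[OF q] by (fastforce simp: diff_le_eq intro: order_trans)
  have "(\<lambda>x\<in>X. p x + (\<lambda>x\<in>X. q x - p x) x) = q"
    using q by (auto simp: fun_eq_iff PiE_def extensional_def)
  with Exp_add[OF p d] predsD[OF q] have "h q = h p + h (\<lambda>x\<in>X. q x - p x)" by simp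
  with Exp_range[OF d] show ?thesis by simp
qed

text \<open>Additivity holds only for sums bounded by 1, and \<open>q + \<epsilon>\<close> may
  exceed 1. Halving all terms makes the sum legitimate, and homogeneity cancels the factor.\<close>

lemma Exp_le_add:
  assumes p: "p \<in> preds X" and q: "q \<in> preds X" and e: "0 \<le> \<epsilon>" "\<epsilon> \<le> 1"
    and le: "\<And>x. x \<in> X \<Longrightarrow> p x \<le> q x + \<epsilon>"
  shows "h p \<le> h q + \<epsilon>"
proof -
  let ?half = "\<lambda>p. \<lambda>x\<in>X. 1 / 2 * p x"
  have half: "?half p \<in> preds X" if "p \<in> preds X" for p
    using predsD[OF that] by force
  have e': "(\<lambda>x\<in>X. \<epsilon> / 2) \<in> preds X" using e by auto
  let ?s = "\<lambda>x\<in>X. ?half q x + (\<lambda>x\<in>X. \<epsilon> / 2) x"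
  have bd: "?half q x + (\<lambda>x\<in>X. \<epsilon> / 2) x \<le> 1" if "x \<in> X" for x
    using predsD[OF q that] e that by simp
  have "h (?half p) \<le> h ?s"
  proof (rule Exp_mono[OF half[OF p]])
    show "?s \<in> preds X"
      using bd predsD[OF q] e by (intro restrict_PiE_iff[THEN iffD2]) (auto intro!: add_nonneg_nonneg)
    fix x assume "x \<in> X"
    then show "?half p x \<le> ?s x" using le[of x] by simp
  qed
  also have "h ?s = h (?half q) + h (\<lambda>x\<in>X. \<epsilon> / 2)"
    by (rule Exp_add[OF half[OF q] e' bd])
  finally show ?thesis
    using Exp_scale[of "1/2" p] Exp_scale[of "1/2" q] Exp_const[of "\<epsilon>/2"] p q e by simp
qed

lemma Exp_lipschitz:
  assumes p: "p \<in> preds X" and q: "q \<in> preds X" and e: "0 \<le> \<epsilon>"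
    and le: "\<And>x. x \<in> X \<Longrightarrow> \<bar>p x - q x\<bar> \<le> \<epsilon>"
  shows "\<bar>h p - h q\<bar> \<le> \<epsilon>"
proof (cases "\<epsilon> \<le> 1")
  case True
  have "h p \<le> h q + \<epsilon>" using le by (intro Exp_le_add p q e True) (simp add: abs_le_iff algebra_simps)
  moreover have "h q \<le> h p + \<epsilon>"
    using le by (intro Exp_le_add p q e True) (simp add: abs_le_iff algebra_simps)
  ultimately show ?thesis by (simp add: abs_le_iff)
next
  case False
  then show ?thesis using Exp_range[OF p] Exp_range[OF q] by auto
qed

lemma Exp_sum:
  assumes "finite J" and "\<And>j. j \<in> J \<Longrightarrow> p j \<in> preds X" and "\<And>x. x \<in> X \<Longrightarrow> (\<Sum>j\<in>J. p j x) \<le> 1"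
  shows "h (\<lambda>x\<in>X. \<Sum>j\<in>J. p j x) = (\<Sum>j\<in>J. h (p j))"
  using assms
proof (induction J)
  case empty
  then show ?case using Exp_zero by (simp add: restrict_def)
next
  case (insert j J)
  have j: "p j \<in> preds X" using insert.prems by simp
  have nn: "0 \<le> p i x" if "i \<in> J" "x \<in> X" for i x using insert.prems(1)[of i] that by (auto dest: predsD)
  have le: "p j x + (\<Sum>i\<in>J. p i x) \<le> 1" if "x \<in> X" for x
    using insert.prems(2)[OF that] insert.hyps by simp
  have le': "(\<Sum>i\<in>J. p i x) \<le> 1" if "x \<in> X" for x
    using le[OF that] predsD[OF j that] by simp
  have s: "(\<lambda>x\<in>X. \<Sum>i\<in>J. p i x) \<in> preds X"
    using nn le' by (auto intro!: sum_nonneg)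
  have "h (\<lambda>x\<in>X. \<Sum>i\<in>insert j J. p i x) = h (\<lambda>x\<in>X. p j x + (\<lambda>x\<in>X. \<Sum>i\<in>J. p i x) x)"
    using insert.hyps by (intro arg_cong[of _ _ h]) auto
  also have "\<dots> = h (p j) + h (\<lambda>x\<in>X. \<Sum>i\<in>J. p i x)"
    using le by (intro Exp_add j s) simp
  also have "h (\<lambda>x\<in>X. \<Sum>i\<in>J. p i x) = (\<Sum>i\<in>J. h (p i))"
    using insert.prems(1) le' by (intro insert.IH) auto
  finally show ?case using insert.hyps by simp
qed

end

section \<open>The operations of the monad\<close>

lemma Exp_map_apply: "p \<in> preds Y \<Longrightarrow> Exp_map X Y f h p = h (\<lambda>x\<in>X. p (f x))"
  unfolding Exp_map_def by (rule restrict_apply')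

lemma Exp_mult_apply: "p \<in> preds X \<Longrightarrow> Exp_mult X h p = h (\<lambda>k\<in>Exp X. k p)"
  unfolding Exp_mult_def by (rule restrict_apply')

lemma Exp_unit_apply: "p \<in> preds X \<Longrightarrow> Exp_unit X x p = p x"
  unfolding Exp_unit_def by (rule restrict_apply')

lemma dist_to_exp_apply: "p \<in> preds X \<Longrightarrow> dist_to_exp X \<phi> p = (\<Sum>x\<in>set_pmf \<phi>. pmf \<phi> x * p x)"
  unfolding dist_to_exp_def by (rule restrict_apply')

lemma Exp_map_in_Exp:
  assumes h: "h \<in> Exp X" and f: "\<And>x. x \<in> X \<Longrightarrow> f x \<in> Y"
  shows "Exp_map X Y f h \<in> Exp Y"
proof -
  have c: "(\<lambda>x\<in>X. p (f x)) \<in> preds X" if "p \<in> preds Y" for p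
    using that f by (rule preds_compose)
  show ?thesis
    unfolding Exp_iff
  proof (intro conjI ballI impI)
    show "Exp_map X Y f h \<in> preds Y \<rightarrow>\<^sub>E {0..1}"
      using Exp_range[OF h c] by (auto simp: Exp_map_def)
    show "Exp_map X Y f h (\<lambda>y\<in>Y. 1) = 1"
      using Exp_one[OF h] f preds_one[of Y] by (simp add: Exp_map_def cong: restrict_cong)
  next
    fix p q assume p: "p \<in> preds Y" and q: "q \<in> preds Y" and le: "\<forall>y\<in>Y. p y + q y \<le> 1"
    have "(\<lambda>y\<in>Y. p y + q y) \<in> preds Y" using p q le by (rule preds_add)
    then show "Exp_map X Y f h (\<lambda>y\<in>Y. p y + q y) = Exp_map X Y f h p + Exp_map X Y f h q"
      using Exp_add[OF h c[OF p] c[OF q]] le f p q by (simp add: Exp_map_def cong: restrict_cong)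
  next
    fix r :: real and p assume r: "r \<in> {0..1}" and p: "p \<in> preds Y"
    have "(\<lambda>y\<in>Y. r * p y) \<in> preds Y" using r p by (rule preds_scale)
    then show "Exp_map X Y f h (\<lambda>y\<in>Y. r * p y) = r * Exp_map X Y f h p"
      using Exp_scale[OF h _ _ c[OF p], of r] r f p by (simp add: Exp_map_def cong: restrict_cong)
  qed
qed

lemma Exp_eqI:
  assumes "h \<in> Exp X" "k \<in> Exp X" "\<And>p. p \<in> preds X \<Longrightarrow> h p = k p"
  shows "h = k"
proof (rule PiE_ext)
  show "h \<in> preds X \<rightarrow>\<^sub>E {0..1}" "k \<in> preds X \<rightarrow>\<^sub>E {0..1}" using assms by (simp_all add: Exp_iff)
qed (rule assms)

lemma Exp_pred_in_preds: "p \<in> preds X \<Longrightarrow> (\<lambda>k\<in>Exp X. k p) \<in> preds (Exp X)"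
  by (auto dest: Exp_range)

lemma Exp_mult_in_Exp:
  assumes h: "h \<in> Exp (Exp X)"
  shows "Exp_mult X h \<in> Exp X"
proof -
  note c = Exp_pred_in_preds
  have one: "(\<lambda>k\<in>Exp X. k (\<lambda>x\<in>X. 1)) = (\<lambda>k\<in>Exp X. 1)"
    by (rule restrict_ext) (rule Exp_one)
  show ?thesis
    unfolding Exp_iff
  proof (intro conjI ballI impI)
    show "Exp_mult X h \<in> preds X \<rightarrow>\<^sub>E {0..1}"
      using Exp_range[OF h c] by (auto simp: Exp_mult_def)
    show "Exp_mult X h (\<lambda>x\<in>X. 1) = 1"
      using Exp_one[OF h] one by (simp add: Exp_mult_def)
  next
    fix p q assume p: "p \<in> preds X" and q: "q \<in> preds X" and le: "\<forall>x\<in>X. p x + q x \<le> 1"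
    have pq: "(\<lambda>x\<in>X. p x + q x) \<in> preds X" using p q le by (rule preds_add)
    have eq: "k (\<lambda>x\<in>X. p x + q x) = k p + k q" if "k \<in> Exp X" for k
      using Exp_add[OF that p q] le by blast
    have "k p + k q \<le> 1" if "k \<in> Exp X" for k
      using Exp_range[OF that pq] eq[OF that] by simp
    then have "h (\<lambda>k\<in>Exp X. k p + k q) = h (\<lambda>k\<in>Exp X. k p) + h (\<lambda>k\<in>Exp X. k q)"
      using Exp_add[OF h c[OF p] c[OF q]] by (simp cong: restrict_cong)
    then show "Exp_mult X h (\<lambda>x\<in>X. p x + q x) = Exp_mult X h p + Exp_mult X h q"
      using p q pq eq by (simp add: Exp_mult_def cong: restrict_cong)
  next
    fix r :: real and p assume r: "r \<in> {0..1}" and p: "p \<in> preds X"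
    have rp: "(\<lambda>x\<in>X. r * p x) \<in> preds X" using r p by (rule preds_scale)
    have eq: "k (\<lambda>x\<in>X. r * p x) = r * k p" if "k \<in> Exp X" for k
      using Exp_scale[OF that _ _ p] r by simp
    show "Exp_mult X h (\<lambda>x\<in>X. r * p x) = r * Exp_mult X h p"
      using Exp_scale[OF h _ _ c[OF p], of r] r p rp eq by (simp add: Exp_mult_def cong: restrict_cong)
  qed
qed

lemma Exp_unit_in_Exp: "x \<in> X \<Longrightarrow> Exp_unit X x \<in> Exp X"
  unfolding Exp_iff Exp_unit_def
proof (intro conjI ballI impI)
  fix p q assume "x \<in> X" "p \<in> preds X" "q \<in> preds X" "\<forall>x\<in>X. p x + q x \<le> 1"
  then show "(\<lambda>p\<in>preds X. p x) (\<lambda>x\<in>X. p x + q x) = (\<lambda>p\<in>preds X. p x) p + (\<lambda>p\<in>preds X. p x) q"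
    using preds_add[of p X q] by simp
next
  fix r :: real and p assume "x \<in> X" "r \<in> {0..1}" "p \<in> preds X"
  then show "(\<lambda>p\<in>preds X. p x) (\<lambda>x\<in>X. r * p x) = r * (\<lambda>p\<in>preds X. p x) p"
    using preds_scale[of r p X] by simp
next
  assume "x \<in> X"
  then show "(\<lambda>p\<in>preds X. p x) (\<lambda>x\<in>X. 1) = 1" using preds_one[of X] by simp
  show "(\<lambda>p\<in>preds X. p x) \<in> preds X \<rightarrow>\<^sub>E {0..1}"
    using predsD[OF _ \<open>x \<in> X\<close>] by (intro restrict_PiE_iff[THEN iffD2]) auto
qed

section \<open>Distributions as expectations\<close>

lemma dist_to_exp_superset:
  assumes "p \<in> preds X" "finite S" "set_pmf \<phi> \<subseteq> S"
  shows "dist_to_exp X \<phi> p = (\<Sum>x\<in>S. pmf \<phi> x * p x)"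
  using assms by (auto simp: dist_to_exp_def set_pmf_iff intro!: sum.mono_neutral_left)

lemma dist_to_exp_in_Exp:
  assumes \<phi>: "\<phi> \<in> Dist X"
  shows "dist_to_exp X \<phi> \<in> Exp X"
proof -
  let ?S = "set_pmf \<phi>"
  have S: "finite ?S" "\<And>x. x \<in> ?S \<Longrightarrow> x \<in> X" using \<phi> by (auto simp: Dist_def)
  have sum1: "(\<Sum>x\<in>?S. pmf \<phi> x) = 1" using S(1) by (intro sum_pmf_eq_1) auto
  have range: "0 \<le> (\<Sum>x\<in>?S. pmf \<phi> x * p x) \<and> (\<Sum>x\<in>?S. pmf \<phi> x * p x) \<le> 1"
    if p: "p \<in> preds X" for p
  proof -
    have "(\<Sum>x\<in>?S. pmf \<phi> x * p x) \<le> (\<Sum>x\<in>?S. pmf \<phi> x)"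
      using predsD[OF p] S by (intro sum_mono) (simp add: mult_left_le)
    moreover have "0 \<le> (\<Sum>x\<in>?S. pmf \<phi> x * p x)"
      using predsD[OF p] S by (intro sum_nonneg) simp
    ultimately show ?thesis using sum1 by simp
  qed
  show ?thesis
    unfolding Exp_iff
  proof (intro conjI ballI impI)
    show "dist_to_exp X \<phi> \<in> preds X \<rightarrow>\<^sub>E {0..1}"
      using range by (auto simp: dist_to_exp_def)
    show "dist_to_exp X \<phi> (\<lambda>x\<in>X. 1) = 1"
      using sum1 S preds_one[of X] by (simp add: dist_to_exp_def)
  next
    fix p q assume p: "p \<in> preds X" and q: "q \<in> preds X" and le: "\<forall>x\<in>X. p x + q x \<le> 1"
    have "(\<lambda>x\<in>X. p x + q x) \<in> preds X" using p q le by (rule preds_add)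
    then show "dist_to_exp X \<phi> (\<lambda>x\<in>X. p x + q x) = dist_to_exp X \<phi> p + dist_to_exp X \<phi> q"
      using p q S by (simp add: dist_to_exp_def distrib_left sum.distrib)
  next
    fix r :: real and p assume r: "r \<in> {0..1}" and p: "p \<in> preds X"
    have "(\<lambda>x\<in>X. r * p x) \<in> preds X" using r p by (rule preds_scale)
    then show "dist_to_exp X \<phi> (\<lambda>x\<in>X. r * p x) = r * dist_to_exp X \<phi> p"
      using p S by (simp add: dist_to_exp_def sum_distrib_left mult.left_commute)
  qed
qed

lemma dist_to_exp_return: "x \<in> X \<Longrightarrow> dist_to_exp X (return_pmf x) = Exp_unit X x"
  by (auto simp: dist_to_exp_def Exp_unit_def)

lemma dist_to_exp_map:
  assumes \<phi>: "\<phi> \<in> Dist X" and f: "\<And>x. x \<in> X \<Longrightarrow> f x \<in> Y"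
  shows "dist_to_exp Y (map_pmf f \<phi>) = Exp_map X Y f (dist_to_exp X \<phi>)"
  unfolding Exp_map_def
proof (subst dist_to_exp_def, intro restrict_ext)
  fix p assume p: "p \<in> preds Y"
  have pf: "(\<lambda>x\<in>X. p (f x)) \<in> preds X" using p f by (rule preds_compose)
  have S: "finite (set_pmf \<phi>)" "\<And>x. x \<in> set_pmf \<phi> \<Longrightarrow> x \<in> X" using \<phi> by (auto simp: Dist_def)
  \<comment> \<open>Integrals replace the regrouping of the sum over the fibres of \<open>f\<close>
    by a change of variables.\<close>
  have "(\<Sum>y\<in>set_pmf (map_pmf f \<phi>). pmf (map_pmf f \<phi>) y * p y) =
    measure_pmf.expectation (map_pmf f \<phi>) p"
    using S by (subst integral_measure_pmf_real[where A="set_pmf (map_pmf f \<phi>)"]) (auto simp: mult.commute)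
  also have "\<dots> = (\<Sum>x\<in>set_pmf \<phi>. pmf \<phi> x * p (f x))"
    using S unfolding integral_map_pmf
    by (subst integral_measure_pmf_real[where A="set_pmf \<phi>"]) (auto simp: mult.commute)
  also have "\<dots> = dist_to_exp X \<phi> (\<lambda>x\<in>X. p (f x))"
    using dist_to_exp_superset[OF pf S(1)] S(2) by simp
  finally show "(\<Sum>y\<in>set_pmf (map_pmf f \<phi>). pmf (map_pmf f \<phi>) y * p y) =
    dist_to_exp X \<phi> (\<lambda>x\<in>X. p (f x))" .
qed

lemma map_pmf_Dist: "\<phi> \<in> Dist X \<Longrightarrow> (\<And>x. x \<in> X \<Longrightarrow> f x \<in> Y) \<Longrightarrow> map_pmf f \<phi> \<in> Dist Y"
  by (auto simp: Dist_def)

lemma join_pmf_Dist: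
  assumes "\<Phi> \<in> Dist (Dist X)" shows "join_pmf \<Phi> \<in> Dist X"
  using assms by (auto simp: Dist_def set_bind_pmf join_pmf_def subset_eq)

lemma dist_to_exp_join:
  assumes \<Phi>: "\<Phi> \<in> Dist (Dist X)" and p: "p \<in> preds X"
  shows "dist_to_exp X (join_pmf \<Phi>) p = (\<Sum>\<psi>\<in>set_pmf \<Phi>. pmf \<Phi> \<psi> * dist_to_exp X \<psi> p)"
proof -
  \<comment> \<open>One finite set containing every support lets all inner sums run over the same
    indices, so that summation can be interchanged.\<close>
  define U where "U = (\<Union>\<psi>\<in>set_pmf \<Phi>. set_pmf \<psi>)"
  have fin: "finite (set_pmf \<Phi>)" "finite U" using \<Phi> by (auto simp: Dist_def U_def)
  have j: "join_pmf \<Phi> = bind_pmf \<Phi> (\<lambda>x. x)" by (simp add: join_pmf_def)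
  have "set_pmf (join_pmf \<Phi>) \<subseteq> U" by (auto simp: U_def j set_bind_pmf)
  then have "dist_to_exp X (join_pmf \<Phi>) p = (\<Sum>x\<in>U. pmf (join_pmf \<Phi>) x * p x)"
    by (intro dist_to_exp_superset p fin)
  also have "\<dots> = (\<Sum>x\<in>U. \<Sum>\<psi>\<in>set_pmf \<Phi>. pmf \<Phi> \<psi> * (pmf \<psi> x * p x))"
    unfolding j pmf_bind
    using fin by (subst integral_measure_pmf_real[where A="set_pmf \<Phi>"])
      (auto simp: sum_distrib_left sum_distrib_right mult_ac intro!: sum.cong)
  also have "\<dots> = (\<Sum>\<psi>\<in>set_pmf \<Phi>. pmf \<Phi> \<psi> * (\<Sum>x\<in>U. pmf \<psi> x * p x))"
    by (subst sum.swap) (simp add: sum_distrib_left)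
  also have "\<dots> = (\<Sum>\<psi>\<in>set_pmf \<Phi>. pmf \<Phi> \<psi> * dist_to_exp X \<psi> p)"
    by (intro sum.cong refl arg_cong2[where f="(*)"] dist_to_exp_superset[symmetric] p fin)
      (auto simp: U_def)
  finally show ?thesis .
qed

section \<open>Approximation of expectations by finitely supported distributions\<close>

text \<open>The predicate \<open>p\<close> after \<open>g\<close> is the combination, with
  coefficients \<open>p y\<close>, of the indicators of the finitely many fibres of
  \<open>g\<close>. So its value under \<open>h\<close> depends only on the values of
  \<open>h\<close> at these indicators, which are the weights of the distribution.\<close>

lemma Exp_map_finite_range:
  assumes h: "h \<in> Exp X" and g: "\<And>x. x \<in> X \<Longrightarrow> g x \<in> X" and fin: "finite (g ` X)"
  obtains \<phi> where "\<phi> \<in> Dist X" "Exp_map X X g h = dist_to_exp X \<phi>"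
proof -
  \<comment> \<open>The explicit 0 outside the range of \<open>g\<close> makes the finite support of
    \<open>embed_pmf w\<close> immediate.\<close>
  define w where "w y = (if y \<in> g ` X then h (\<lambda>x\<in>X. of_bool (g x = y)) else 0)" for y
  have ind: "(\<lambda>x\<in>X. of_bool (g x = y)) \<in> preds X" for y by auto
  have w0: "0 \<le> w y" for y using Exp_range[OF h ind] by (simp add: w_def)
  have key: "h (\<lambda>x\<in>X. p (g x)) = (\<Sum>y\<in>g ` X. w y * p y)" if p: "p \<in> preds X" for p
  proof -
    let ?q = "\<lambda>y. \<lambda>x\<in>X. p y * (\<lambda>x\<in>X. of_bool (g x = y)) x"
    have py: "0 \<le> p y \<and> p y \<le> 1" if "y \<in> g ` X" for y
      using predsD[OF p] g that by blast
    have eq: "p (g x) = (\<Sum>y\<in>g ` X. ?q y x)" if "x \<in> X" for x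
    proof -
      have "(\<Sum>y\<in>g ` X. ?q y x) = (\<Sum>y\<in>g ` X. if g x = y then p y else 0)"
        using that by (intro sum.cong) auto
      then show ?thesis using that fin by simp
    qed
    have "h (\<lambda>x\<in>X. p (g x)) = h (\<lambda>x\<in>X. \<Sum>y\<in>g ` X. ?q y x)"
      using eq by (intro arg_cong[of _ _ h] restrict_ext)
    also have "\<dots> = (\<Sum>y\<in>g ` X. h (?q y))"
    proof (rule Exp_sum[OF h fin])
      show "?q y \<in> preds X" if "y \<in> g ` X" for y using py[OF that] by auto
      show "(\<Sum>y\<in>g ` X. ?q y x) \<le> 1" if "x \<in> X" for x
        using eq[OF that] py[of "g x"] that by simp
    qed
    also have "\<dots> = (\<Sum>y\<in>g ` X. w y * p y)"
    proof (rule sum.cong[OF refl])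
      fix y assume y: "y \<in> g ` X"
      then have "h (?q y) = p y * h (\<lambda>x\<in>X. of_bool (g x = y))"
        using py[OF y] by (intro Exp_scale[OF h _ _ ind]) auto
      then show "h (?q y) = w y * p y" using y by (simp only: w_def if_True mult.commute)
    qed
    finally show ?thesis .
  qed
  \<comment> \<open>The constant predicate 1 yields the total mass.\<close>
  from key[OF preds_one] have "(\<Sum>y\<in>g ` X. w y * (\<lambda>x\<in>X. 1) y) = 1"
    using g Exp_one[OF h] by (simp cong: restrict_cong)
  moreover have "(\<Sum>y\<in>g ` X. w y * (\<lambda>x\<in>X. 1) y) = (\<Sum>y\<in>g ` X. w y)"
    using g by (intro sum.cong) auto
  ultimately have sum1: "(\<Sum>y\<in>g ` X. w y) = 1" by simp
  have nn: "(\<integral>\<^sup>+y. ennreal (w y) \<partial>count_space UNIV) = 1"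
  proof (subst nn_integral_count_space'[OF fin])
    show "ennreal (w y) = 0" if "y \<notin> g ` X" for y using that by (simp add: w_def)
    show "(\<Sum>y\<in>g ` X. ennreal (w y)) = 1" using w0 sum1 by (simp add: sum_ennreal)
  qed simp
  have pmf_w: "pmf (embed_pmf w) y = w y" for y by (rule pmf_embed_pmf[OF w0 nn])
  have set_w: "set_pmf (embed_pmf w) \<subseteq> g ` X"
    unfolding set_embed_pmf[OF w0 nn] by (auto simp: w_def split: if_splits)
  have "embed_pmf w \<in> Dist X"
    using set_w fin g by (auto simp: Dist_def intro: finite_subset)
  moreover have "Exp_map X X g h = dist_to_exp X (embed_pmf w)"
  proof (rule Exp_eqI)
    show "Exp_map X X g h \<in> Exp X" using h g by (rule Exp_map_in_Exp)
    show "dist_to_exp X (embed_pmf w) \<in> Exp X" by (rule dist_to_exp_in_Exp) fact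
    fix p assume "p \<in> preds X"
    then show "Exp_map X X g h p = dist_to_exp X (embed_pmf w) p"
      using dist_to_exp_superset[OF _ fin set_w] by (simp add: Exp_map_def key pmf_w)
  qed
  ultimately show thesis by (rule that)
qed

text \<open>Replacing every point by a representative of its class, where two points are equivalent if
  they agree on \<open>P\<close> up to rounding, changes each predicate in \<open>P\<close> by at most \<open>\<epsilon>\<close>.\<close>

lemma dist_to_exp_dense:
  assumes h: "h \<in> Exp X" and P: "finite P" "P \<subseteq> preds X" and e: "0 < \<epsilon>"
  obtains \<phi> where "\<phi> \<in> Dist X" "\<And>p. p \<in> P \<Longrightarrow> \<bar>dist_to_exp X \<phi> p - h p\<bar> \<le> \<epsilon>"
proof -
  define \<kappa> where "\<kappa> x = (\<lambda>p\<in>P. \<lfloor>p x / \<epsilon>\<rfloor>)" for x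
  define g where "g x = inv_into X \<kappa> (\<kappa> x)" for x
  have "\<kappa> x \<in> P \<rightarrow>\<^sub>E {0..\<lfloor>1 / \<epsilon>\<rfloor>}" if x: "x \<in> X" for x
  proof -
    have "0 \<le> p x / \<epsilon>" "p x / \<epsilon> \<le> 1 / \<epsilon>" if "p \<in> P" for p
      using predsD[OF _ x, of p] that P(2) e by (auto simp: divide_right_mono)
    then show ?thesis unfolding \<kappa>_def by (auto intro!: floor_mono)
  qed
  then have "\<kappa> ` X \<subseteq> P \<rightarrow>\<^sub>E {0..\<lfloor>1 / \<epsilon>\<rfloor>}" by (rule image_subsetI)
  moreover have "finite (P \<rightarrow>\<^sub>E {0..\<lfloor>1 / \<epsilon>\<rfloor>})" using P(1) by (intro finite_PiE) simp_all
  ultimately have "finite (\<kappa> ` X)" by (rule finite_subset)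
  moreover have "g ` X = inv_into X \<kappa> ` \<kappa> ` X" unfolding g_def image_image ..
  ultimately have fin: "finite (g ` X)" by simp
  have g: "g x \<in> X" "\<kappa> (g x) = \<kappa> x" if "x \<in> X" for x
    using that by (auto simp: g_def inv_into_into f_inv_into_f)
  obtain \<phi> where \<phi>: "\<phi> \<in> Dist X" "Exp_map X X g h = dist_to_exp X \<phi>"
    using Exp_map_finite_range[OF h g(1) fin] by blast
  have "\<bar>dist_to_exp X \<phi> p - h p\<bar> \<le> \<epsilon>" if p: "p \<in> P" for p
  proof -
    have pX: "p \<in> preds X" using P p by blast
    have "\<bar>h (\<lambda>x\<in>X. p (g x)) - h p\<bar> \<le> \<epsilon>"
    proof (rule Exp_lipschitz[OF h preds_compose[OF pX g(1)] pX])
      fix x assume x: "x \<in> X"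
      have "\<kappa> (g x) p = \<kappa> x p" by (simp only: g(2)[OF x])
      then have "\<lfloor>p (g x) / \<epsilon>\<rfloor> = \<lfloor>p x / \<epsilon>\<rfloor>" using p by (simp only: \<kappa>_def restrict_apply')
      then have "\<bar>p (g x) / \<epsilon> - p x / \<epsilon>\<bar> < 1" by linarith
      then have "\<bar>(p (g x) - p x) / \<epsilon>\<bar> < 1" by (simp add: diff_divide_distrib)
      then have "\<bar>p (g x) - p x\<bar> < \<epsilon>" using e by (simp add: abs_divide)
      then show "\<bar>(\<lambda>x\<in>X. p (g x)) x - p x\<bar> \<le> \<epsilon>" using x by simp
    qed (use e in auto)
    then show ?thesis using pX by (simp only: \<phi>(2)[symmetric] Exp_map_def restrict_apply')
  qed
  with \<phi>(1) show thesis by (rule that)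
qed

text \<open>A pair of a predicate and a tolerance is a condition on distributions. Finitely many
  such conditions hold jointly, by density with the smallest tolerance, so one ultrafilter on
  \<open>Dist X\<close> meets them all.\<close>

lemma Exp_ultra_limit:
  assumes h: "h \<in> Exp X"
  obtains \<Phi> where "ultra_on (Dist X) \<Phi>"
    "\<And>p. p \<in> preds X \<Longrightarrow> ((\<lambda>\<phi>. dist_to_exp X \<phi> p) \<longlongrightarrow> h p) \<Phi>"
proof -
  let ?Q = "\<lambda>(p, \<epsilon>) \<phi>. \<bar>dist_to_exp X \<phi> p - h p\<bar> \<le> \<epsilon>"
  have "\<exists>\<phi>\<in>Dist X. \<forall>i\<in>J. ?Q i \<phi>" if J: "finite J" "J \<subseteq> preds X \<times> {0<..}" for J
  proof -
    \<comment> \<open>The 1 keeps \<open>Min\<close> meaningful for empty \<open>J\<close>.\<close>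
    define \<epsilon> where "\<epsilon> = Min (insert 1 (snd ` J))"
    have e: "0 < \<epsilon>" "\<And>i. i \<in> J \<Longrightarrow> \<epsilon> \<le> snd i" using J by (auto simp: \<epsilon>_def)
    obtain \<phi> where \<phi>: "\<phi> \<in> Dist X" "\<And>p. p \<in> fst ` J \<Longrightarrow> \<bar>dist_to_exp X \<phi> p - h p\<bar> \<le> \<epsilon>"
    proof (rule dist_to_exp_dense[OF h _ _ e(1)])
      show "finite (fst ` J)" using J(1) by (rule finite_imageI)
      show "fst ` J \<subseteq> preds X" using J(2) by (metis fst_image_times image_mono order_trans empty_subsetI order_refl)
    qed blast
    have "?Q i \<phi>" if "i \<in> J" for i
      using \<phi>(2)[of "fst i"] e(2)[OF that] that by (auto simp: case_prod_beta)
    with \<phi>(1) show ?thesis by blast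
  qed
  then obtain \<Phi> where \<Phi>1: "ultra_on (Dist X) \<Phi>"
    and \<Phi>2: "\<And>i. i \<in> preds X \<times> {0<..} \<Longrightarrow> eventually (?Q i) \<Phi>"
    by (rule ex_ultra_on_INF[where P="?Q" and I="preds X \<times> {0<..}" and X="Dist X"]) iprover+
  have "((\<lambda>\<phi>. dist_to_exp X \<phi> p) \<longlongrightarrow> h p) \<Phi>" if "p \<in> preds X" for p
  proof (rule tendstoI)
    fix \<epsilon> :: real assume "0 < \<epsilon>"
    then have "eventually (?Q (p, \<epsilon> / 2)) \<Phi>" using that by (intro \<Phi>2) auto
    then show "eventually (\<lambda>\<phi>. dist (dist_to_exp X \<phi> p) (h p) < \<epsilon>) \<Phi>"
      by eventually_elim (use \<open>0 < \<epsilon>\<close> in \<open>auto simp: dist_real_def\<close>)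
  qed
  with \<Phi>1 show thesis by (rule that)
qed

section \<open>Ultrafilters as expectations\<close>

text \<open>The infimum defining \<tau> is taken over the eventual upper bounds of \<open>p\<close>.
  A number of [0,1] below it is not such a bound, and in an ultrafilter the opposite strict
  inequality then holds eventually. Other properties of \<open>uf_to_exp\<close> follow from this by
  uniqueness of limits.\<close>

lemma tendsto_uf_to_exp:
  assumes \<Phi>: "ultra_on X \<Phi>" and p: "p \<in> preds X"
  shows "(p \<longlongrightarrow> uf_to_exp X (filter_sets X \<Phi>) p) \<Phi>"
proof -
  have X: "eventually (\<lambda>x. x \<in> X) \<Phi>" using \<Phi> by (rule ultra_on_carrier)
  have mem: "{x \<in> X. p x \<le> s} \<in> filter_sets X \<Phi> \<longleftrightarrow> eventually (\<lambda>x. p x \<le> s) \<Phi>" for s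
    using X by (auto simp: filter_sets_def elim: eventually_elim2 eventually_mono)
  define S where "S = {s \<in> {0..1}. eventually (\<lambda>x. p x \<le> s) \<Phi>}"
  have u: "uf_to_exp X (filter_sets X \<Phi>) p = Inf S"
    using p by (simp add: uf_to_exp_def S_def mem)
  have "1 \<in> S" unfolding S_def using X by (auto elim!: eventually_mono dest: predsD[OF p])
  then have ne: "S \<noteq> {}" by blast
  have bdd: "bdd_below S" by (auto simp: S_def)
  show ?thesis
    unfolding u
  proof (rule order_tendstoI)
    fix a assume a: "Inf S < a"
    then obtain s where "s \<in> S" "s < a" using cInf_lessD[OF ne a] by blast
    then show "eventually (\<lambda>x. p x < a) \<Phi>" by (auto simp: S_def elim: eventually_mono)
  next
    fix a assume a: "a < Inf S"
    show "eventually (\<lambda>x. a < p x) \<Phi>"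
    \<comment> \<open>The infimum tests only thresholds in [0,1]; for negative \<open>a\<close> the
      nonnegativity of \<open>p\<close> takes over.\<close>
    proof (cases "0 \<le> a")
      case True
      have "a \<notin> S" using cInf_lower[OF _ bdd, of a] a by auto
      moreover have "a \<le> 1" using cInf_lower[OF \<open>1 \<in> S\<close> bdd] a by simp
      ultimately have "\<not> eventually (\<lambda>x. p x \<le> a) \<Phi>" using True by (simp add: S_def)
      then show ?thesis using ultra_on_not[OF \<Phi>, of "\<lambda>x. p x \<le> a"] by (simp add: not_le)
    next
      case False
      show ?thesis using X by eventually_elim (use False predsD[OF p] in force)
    qed
  qed
qed

lemma uf_to_exp_eqI:
  "ultra_on X \<Phi> \<Longrightarrow> p \<in> preds X \<Longrightarrow> (p \<longlongrightarrow> r) \<Phi> \<Longrightarrow> uf_to_exp X (filter_sets X \<Phi>) p = r"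
  by (rule tendsto_unique[OF ultra_on_not_bot tendsto_uf_to_exp])

lemma tendsto_eventually_cong:
  "(f \<longlongrightarrow> l) F \<Longrightarrow> eventually (\<lambda>x. f x = g x) F \<Longrightarrow> (g \<longlongrightarrow> l) F"
  using tendsto_cong by blast

text \<open>The conditions in \<open>Exp_iff\<close> are equations and weak inequalities between
  finitely many values, hence survive pointwise limits. Extensionality of \<open>L\<close> is a
  separate premise because the limits say nothing outside the predicates.\<close>

lemma ultra_limit_in_Exp:
  assumes G: "ultra_on I G" and k: "\<And>i. i \<in> I \<Longrightarrow> k i \<in> Exp X"
    and L: "\<And>p. p \<in> preds X \<Longrightarrow> ((\<lambda>i. k i p) \<longlongrightarrow> L p) G" "L \<in> extensional (preds X)"
  shows "L \<in> Exp X"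
proof -
  have I: "eventually (\<lambda>i. i \<in> I) G" using G by (rule ultra_on_carrier)
  have bot: "G \<noteq> bot" using G by (rule ultra_on_not_bot)
  have unique: "L p = l" if "p \<in> preds X" "(f \<longlongrightarrow> l) G" "\<And>i. i \<in> I \<Longrightarrow> f i = k i p" for p f l
  proof (rule tendsto_unique[OF bot L(1)[OF that(1)]])
    show "((\<lambda>i. k i p) \<longlongrightarrow> l) G"
      by (rule tendsto_eventually_cong[OF that(2)]) (use I that(3) in \<open>auto elim: eventually_mono\<close>)
  qed
  show ?thesis
    unfolding Exp_iff
  proof (intro conjI ballI impI)
    have "L p \<in> {0..1}" if p: "p \<in> preds X" for p
    proof -
      have "0 \<le> L p"
        by (rule tendsto_lowerbound[OF L(1)[OF p] _ bot]) (use I Exp_range[OF k p] in \<open>auto elim: eventually_mono\<close>)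
      moreover have "L p \<le> 1"
        by (rule tendsto_upperbound[OF L(1)[OF p] _ bot]) (use I Exp_range[OF k p] in \<open>auto elim: eventually_mono\<close>)
      ultimately show ?thesis by simp
    qed
    with L(2) show "L \<in> preds X \<rightarrow>\<^sub>E {0..1}" by (simp add: PiE_def)
    show "L (\<lambda>x\<in>X. 1) = 1" by (rule unique[OF preds_one tendsto_const]) (simp add: Exp_one[OF k])
  next
    fix p q assume p: "p \<in> preds X" and q: "q \<in> preds X" and le: "\<forall>x\<in>X. p x + q x \<le> 1"
    have "(\<lambda>x\<in>X. p x + q x) \<in> preds X" using p q le by (rule preds_add)
    then show "L (\<lambda>x\<in>X. p x + q x) = L p + L q"
      by (rule unique[OF _ tendsto_add[OF L(1)[OF p] L(1)[OF q]]]) (use Exp_add[OF k p q] le in simp)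
  next
    fix r :: real and p assume r: "r \<in> {0..1}" and p: "p \<in> preds X"
    have "(\<lambda>x\<in>X. r * p x) \<in> preds X" using r p by (rule preds_scale)
    then show "L (\<lambda>x\<in>X. r * p x) = r * L p"
      by (rule unique[OF _ tendsto_mult_left[OF L(1)[OF p]]]) (use Exp_scale[OF k _ _ p] r in simp)
  qed
qed

lemma uf_to_exp_in_Exp:
  assumes \<Phi>: "ultra_on X \<Phi>"
  shows "uf_to_exp X (filter_sets X \<Phi>) \<in> Exp X"
proof (rule ultra_limit_in_Exp[OF \<Phi>])
  show "Exp_unit X x \<in> Exp X" if "x \<in> X" for x using that by (rule Exp_unit_in_Exp)
  show "((\<lambda>x. Exp_unit X x p) \<longlongrightarrow> uf_to_exp X (filter_sets X \<Phi>) p) \<Phi>" if "p \<in> preds X" for p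
    using tendsto_uf_to_exp[OF \<Phi> that] that by (simp add: Exp_unit_def)
qed (simp add: uf_to_exp_def)

text \<open>Naturality of \<tau>: at \<open>p\<close>, both sides are the limit of \<open>p\<close>
  after \<open>f\<close> along \<Phi>.\<close>

lemma uf_to_exp_filtermap:
  assumes \<Phi>: "ultra_on X \<Phi>" and f: "\<And>x. x \<in> X \<Longrightarrow> f x \<in> Y"
  shows "uf_to_exp Y (filter_sets Y (filtermap f \<Phi>)) = Exp_map X Y f (uf_to_exp X (filter_sets X \<Phi>))"
proof (rule Exp_eqI)
  have \<Psi>: "ultra_on Y (filtermap f \<Phi>)" using \<Phi> f by (rule ultra_on_filtermap)
  then show "uf_to_exp Y (filter_sets Y (filtermap f \<Phi>)) \<in> Exp Y" by (rule uf_to_exp_in_Exp)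
  show "Exp_map X Y f (uf_to_exp X (filter_sets X \<Phi>)) \<in> Exp Y"
    using uf_to_exp_in_Exp[OF \<Phi>] f by (rule Exp_map_in_Exp)
  fix p assume p: "p \<in> preds Y"
  have "((\<lambda>x\<in>X. p (f x)) \<longlongrightarrow> uf_to_exp X (filter_sets X \<Phi>) (\<lambda>x\<in>X. p (f x))) \<Phi>"
    using preds_compose[OF p f] by (rule tendsto_uf_to_exp[OF \<Phi>])
  then have "((\<lambda>x. p (f x)) \<longlongrightarrow> uf_to_exp X (filter_sets X \<Phi>) (\<lambda>x\<in>X. p (f x))) \<Phi>"
    by (rule tendsto_eventually_cong) (use ultra_on_carrier[OF \<Phi>] in \<open>auto elim: eventually_mono\<close>)
  then have "(p \<longlongrightarrow> uf_to_exp X (filter_sets X \<Phi>) (\<lambda>x\<in>X. p (f x))) (filtermap f \<Phi>)"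
    by (simp add: filterlim_filtermap)
  from uf_to_exp_eqI[OF \<Psi> p this]
  show "uf_to_exp Y (filter_sets Y (filtermap f \<Phi>)) p = Exp_map X Y f (uf_to_exp X (filter_sets X \<Phi>)) p"
    using p by (simp add: Exp_map_def)
qed

lemma uf_to_exp_principal:
  assumes "x \<in> X"
  shows "uf_to_exp X (filter_sets X (principal {x})) = Exp_unit X x"
proof (rule Exp_eqI)
  note u = ultra_on_principal[OF assms]
  then show "uf_to_exp X (filter_sets X (principal {x})) \<in> Exp X" by (rule uf_to_exp_in_Exp)
  show "Exp_unit X x \<in> Exp X" using assms by (rule Exp_unit_in_Exp)
  fix p assume p: "p \<in> preds X"
  have "(p \<longlongrightarrow> p x) (principal {x})"
    by (auto simp: tendsto_def eventually_principal)
  from uf_to_exp_eqI[OF u p this] show "uf_to_exp X (filter_sets X (principal {x})) p = Exp_unit X x p"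
    using p by (simp add: Exp_unit_def)
qed

section \<open>Algebras of the expectation monad\<close>

lemma exp_alg_closed: "is_exp_alg A \<Longrightarrow> h \<in> Exp (acarrier A) \<Longrightarrow> astruct A h \<in> acarrier A"
  unfolding is_exp_alg_def Let_def by (auto dest: PiE_mem)

lemma exp_alg_unit: "is_exp_alg A \<Longrightarrow> x \<in> acarrier A \<Longrightarrow> astruct A (Exp_unit (acarrier A) x) = x"
  unfolding is_exp_alg_def Let_def by blast

lemma exp_alg_mult:
  "is_exp_alg A \<Longrightarrow> H \<in> Exp (Exp (acarrier A)) \<Longrightarrow>
    astruct A (Exp_mult (acarrier A) H) =
    astruct A (Exp_map (Exp (acarrier A)) (acarrier A) (astruct A) H)"
  unfolding is_exp_alg_def Let_def by blast

text \<open>The ultrafilter algebra obtained from \<alpha> and \<tau>, read on filters of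
  predicates.\<close>

definition alg_lim :: "'a exp_alg \<Rightarrow> 'a filter \<Rightarrow> 'a" where
  "alg_lim A \<Phi> = astruct A (uf_to_exp (acarrier A) (filter_sets (acarrier A) \<Phi>))"

lemma alg_lim_closed: "is_exp_alg A \<Longrightarrow> ultra_on (acarrier A) \<Phi> \<Longrightarrow> alg_lim A \<Phi> \<in> acarrier A"
  unfolding alg_lim_def by (intro exp_alg_closed uf_to_exp_in_Exp)

lemma alg_lim_principal: "is_exp_alg A \<Longrightarrow> x \<in> acarrier A \<Longrightarrow> alg_lim A (principal {x}) = x"
  by (simp add: alg_lim_def uf_to_exp_principal exp_alg_unit)

text \<open>Push \<open>G\<close> forward along \<open>k\<close> to an ultrafilter of expectations
  and let \<open>H\<close> be its image under \<tau>. The monad multiplication sends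
  \<open>H\<close> to the pointwise limit \<open>L\<close>, while mapping \<open>H\<close> along
  \<alpha> gives the expectation of the ultrafilter pushed on to the carrier. The multiplication law
  equates their values under \<alpha>.\<close>

lemma astruct_limit:
  assumes A: "is_exp_alg A" and G: "ultra_on I G" and k: "\<And>i. i \<in> I \<Longrightarrow> k i \<in> Exp (acarrier A)"
    and L: "L \<in> Exp (acarrier A)" "\<And>p. p \<in> preds (acarrier A) \<Longrightarrow> ((\<lambda>i. k i p) \<longlongrightarrow> L p) G"
  shows "astruct A L = alg_lim A (filtermap (\<lambda>i. astruct A (k i)) G)"
proof -
  let ?X = "acarrier A"
  let ?K = "filtermap k G"
  define H where "H = uf_to_exp (Exp ?X) (filter_sets (Exp ?X) ?K)"
  have K: "ultra_on (Exp ?X) ?K" using G k by (rule ultra_on_filtermap)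
  have H: "H \<in> Exp (Exp ?X)" unfolding H_def using K by (rule uf_to_exp_in_Exp)
  have "Exp_mult ?X H = L"
  proof (rule Exp_eqI[OF Exp_mult_in_Exp[OF H] L(1)])
    fix p assume p: "p \<in> preds ?X"
    have "((\<lambda>k\<in>Exp ?X. k p) \<longlongrightarrow> L p) ?K"
      unfolding filterlim_filtermap
    proof (rule tendsto_eventually_cong[OF L(2)[OF p]])
      show "eventually (\<lambda>i. k i p = (\<lambda>k\<in>Exp ?X. k p) (k i)) G"
        using ultra_on_carrier[OF G] by eventually_elim (simp add: k)
    qed
    then have "H (\<lambda>k\<in>Exp ?X. k p) = L p"
      unfolding H_def by (rule uf_to_exp_eqI[OF K Exp_pred_in_preds[OF p]])
    then show "Exp_mult ?X H p = L p" using p by (simp add: Exp_mult_def)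
  qed
  moreover have "astruct A (Exp_map (Exp ?X) ?X (astruct A) H) =
      alg_lim A (filtermap (astruct A) ?K)"
    unfolding H_def alg_lim_def
    by (subst uf_to_exp_filtermap[OF K exp_alg_closed[OF A]]) simp_all
  ultimately show ?thesis
    using exp_alg_mult[OF A H] by (simp add: filtermap_filtermap)
qed

text \<open>The multiplication law of the ultrafilter algebra. By \<open>astruct_limit\<close> it
  suffices that the expectations of the \<open>F i\<close> converge along \<open>G\<close> to that
  of \<Phi>.\<close>

lemma alg_lim_sum:
  assumes A: "is_exp_alg A" and G: "ultra_on I G"
    and F: "\<And>i. i \<in> I \<Longrightarrow> ultra_on (acarrier A) (F i)" and \<Phi>: "ultra_on (acarrier A) \<Phi>"
    and ev: "\<And>P. eventually P \<Phi> \<longleftrightarrow> eventually (\<lambda>i. eventually P (F i)) G"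
  shows "alg_lim A \<Phi> = alg_lim A (filtermap (\<lambda>i. alg_lim A (F i)) G)"
proof -
  let ?u = "\<lambda>\<Psi>. uf_to_exp (acarrier A) (filter_sets (acarrier A) \<Psi>)"
  have lim: "((\<lambda>i. ?u (F i) p) \<longlongrightarrow> ?u \<Phi> p) G" if p: "p \<in> preds (acarrier A)" for p
  proof (rule tendstoI)
    fix e :: real assume e: "0 < e"
    \<comment> \<open>Half of \<open>e\<close> leaves room for the strict inequality to become weak
      in the limit along \<open>F i\<close>.\<close>
    have "eventually (\<lambda>x. dist (p x) (?u \<Phi> p) < e / 2) \<Phi>"
      using e by (intro tendstoD tendsto_uf_to_exp \<Phi> p) simp
    then have "eventually (\<lambda>i. eventually (\<lambda>x. dist (p x) (?u \<Phi> p) < e / 2) (F i)) G"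
      by (simp add: ev)
    with ultra_on_carrier[OF G] show "eventually (\<lambda>i. dist (?u (F i) p) (?u \<Phi> p) < e) G"
    proof eventually_elim
      case (elim i)
      have "((\<lambda>x. dist (p x) (?u \<Phi> p)) \<longlongrightarrow> dist (?u (F i) p) (?u \<Phi> p)) (F i)"
        using elim(1) by (intro tendsto_dist tendsto_uf_to_exp F p tendsto_const)
      then have "dist (?u (F i) p) (?u \<Phi> p) \<le> e / 2"
      proof (rule tendsto_upperbound)
        show "eventually (\<lambda>x. dist (p x) (?u \<Phi> p) \<le> e / 2) (F i)"
          using elim(2) by (rule eventually_mono) simp
        show "F i \<noteq> bot" using F[OF elim(1)] by (rule ultra_on_not_bot)
      qed
      with e show ?case by simp
    qed
  qed
  show ?thesis
    unfolding alg_lim_def[of A \<Phi>] alg_lim_def[of A "F _"]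
    by (rule astruct_limit[OF A G uf_to_exp_in_Exp[OF F] uf_to_exp_in_Exp[OF \<Phi>] lim])
qed

section \<open>The compact Hausdorff topology of an algebra\<close>

definition alg_top :: "'a exp_alg \<Rightarrow> 'a topology" where
  "alg_top A = ctop (exp_alg_to_cch A)"

lemma alg_top_eq: "alg_top A = uf_topology (acarrier A) (\<lambda>F. astruct A (uf_to_exp (acarrier A) F))"
  by (simp add: alg_top_def exp_alg_to_cch_def Let_def)

lemma cconv_exp_alg_to_cch:
  "cconv (exp_alg_to_cch A) = (\<lambda>\<phi>\<in>Dist (acarrier A). astruct A (dist_to_exp (acarrier A) \<phi>))"
  by (simp add: exp_alg_to_cch_def Let_def)

lemma ccarrier_exp_alg_to_cch: "ccarrier (exp_alg_to_cch A) = acarrier A"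
  by (simp add: exp_alg_to_cch_def Let_def)

context
  fixes A :: "'a exp_alg"
  assumes A: "is_exp_alg A"
begin

lemma alg_top_map: "(\<lambda>F. astruct A (uf_to_exp (acarrier A) F)) \<in> ultrafilters (acarrier A) \<rightarrow> acarrier A"
proof
  fix F assume "F \<in> ultrafilters (acarrier A)"
  then obtain \<Phi> where "ultra_on (acarrier A) \<Phi>" "F = filter_sets (acarrier A) \<Phi>"
    by (rule ultrafilter_eq_filter_sets)
  then show "astruct A (uf_to_exp (acarrier A) F) \<in> acarrier A"
    using alg_lim_closed[OF A] by (simp add: alg_lim_def)
qed

lemma topspace_alg_top: "topspace (alg_top A) = acarrier A"
  unfolding alg_top_eq by (rule topspace_uf_topology[OF alg_top_map])

lemma closedin_alg_top:
  "closedin (alg_top A) U \<longleftrightarrow> U \<subseteq> acarrier A \<and>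
    (\<forall>\<Phi>. ultra_on (acarrier A) \<Phi> \<and> eventually (\<lambda>x. x \<in> U) \<Phi> \<longrightarrow> alg_lim A \<Phi> \<in> U)"
  unfolding alg_top_eq closedin_uf_topology_ultra[OF alg_top_map] alg_lim_def ..

text \<open>Idempotence of the closure: given an ultrafilter \<open>G\<close> on this set of limits,
  choose for each of its points an ultrafilter that contains \<open>S\<close> and has this point as
  \<open>alg_lim\<close>. Their sum along \<open>G\<close> still contains \<open>S\<close> and has
  the same \<open>alg_lim\<close> as \<open>G\<close>.\<close>

lemma closedin_alg_lims:
  assumes "S \<subseteq> acarrier A"
  shows "closedin (alg_top A)
    {alg_lim A \<Psi> | \<Psi>. ultra_on (acarrier A) \<Psi> \<and> eventually (\<lambda>x. x \<in> S) \<Psi>}" (is "closedin _ ?C")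
  unfolding closedin_alg_top
proof (intro conjI allI impI)
  show "?C \<subseteq> acarrier A" using alg_lim_closed[OF A] by auto
next
  fix G assume "ultra_on (acarrier A) G \<and> eventually (\<lambda>x. x \<in> ?C) G"
  then have G: "ultra_on (acarrier A) G" "eventually (\<lambda>x. x \<in> ?C) G" by blast+
  \<comment> \<open>The choice has to cover the whole carrier. Points outside the set receive their
    principal ultrafilter, so \<open>S\<close> is demanded only conditionally.\<close>
  let ?P = "\<lambda>x \<Psi>. ultra_on (acarrier A) \<Psi> \<and> alg_lim A \<Psi> = x \<and> (x \<in> ?C \<longrightarrow> eventually (\<lambda>x. x \<in> S) \<Psi>)"
  have "\<forall>x\<in>acarrier A. \<exists>\<Psi>. ?P x \<Psi>"
  proof
    fix x assume x: "x \<in> acarrier A"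
    show "\<exists>\<Psi>. ?P x \<Psi>"
    proof (cases "x \<in> ?C")
    case False
      then have "?P x (principal {x})"
        using ultra_on_principal[OF x] alg_lim_principal[OF A x] by iprover
      then show ?thesis by (rule exI)
    qed auto
  qed
  from bchoice[OF this] obtain F where F': "\<forall>x\<in>acarrier A. ?P x (F x)" ..
  then have F: "ultra_on (acarrier A) (F x)" and lim: "alg_lim A (F x) = x"
    and S: "x \<in> ?C \<Longrightarrow> eventually (\<lambda>x. x \<in> S) (F x)" if "x \<in> acarrier A" for x
    using bspec[OF F' that] by iprover+
  obtain \<Theta> where \<Theta>: "ultra_on (acarrier A) \<Theta>"
    and ev: "\<And>P. eventually P \<Theta> \<longleftrightarrow> eventually (\<lambda>i. eventually P (F i)) G"
    by (rule ex_ultra_filter_sum[OF G(1) F]) iprover+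
  have "filtermap (\<lambda>x. alg_lim A (F x)) G = G"
    by (rule filtermap_eventually_ident)
      (use ultra_on_carrier[OF G(1)] lim in \<open>auto elim: eventually_mono\<close>)
  then have "alg_lim A G = alg_lim A \<Theta>"
    using alg_lim_sum[OF A G(1) F \<Theta> ev] by simp
  moreover have "eventually (\<lambda>x. x \<in> S) \<Theta>"
    unfolding ev using ultra_on_carrier[OF G(1)] G(2) by eventually_elim (rule S)
  ultimately show "alg_lim A G \<in> ?C" using \<Theta> by blast
qed

text \<open>If \<open>\<Phi>\<close> converges to \<open>l\<close>, then every \<open>S\<close> in \<open>\<Phi>\<close> carries an ultrafilter whose \<^const>\<open>alg_lim\<close>
  is \<open>l\<close>; summing these along an ultrafilter on the index set \<open>\<Phi>\<close> that refines inclusion gives back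
  \<open>\<Phi>\<close>.\<close>

lemma limitin_alg_top:
  assumes \<Phi>: "ultra_on (acarrier A) \<Phi>"
  shows "limitin (alg_top A) (\<lambda>x. x) l \<Phi> \<longleftrightarrow> l = alg_lim A \<Phi>"
proof
  assume l: "l = alg_lim A \<Phi>"
  show "limitin (alg_top A) (\<lambda>x. x) l \<Phi>"
    unfolding limitin_def topspace_alg_top
  proof (intro conjI allI impI)
    show "l \<in> acarrier A" using alg_lim_closed[OF A \<Phi>] l by simp
    fix U assume U: "openin (alg_top A) U \<and> l \<in> U"
    show "eventually (\<lambda>x. x \<in> U) \<Phi>"
    proof (rule ccontr)
      assume "\<not> eventually (\<lambda>x. x \<in> U) \<Phi>"
      then have "eventually (\<lambda>x. x \<notin> U) \<Phi>" using ultra_on_not[OF \<Phi>] by blast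
      then have "eventually (\<lambda>x. x \<in> acarrier A - U) \<Phi>"
        using ultra_on_carrier[OF \<Phi>] by eventually_elim simp
      moreover have "closedin (alg_top A) (acarrier A - U)"
        using U openin_closedin_eq[of "alg_top A" U] by (simp add: topspace_alg_top)
      ultimately have "alg_lim A \<Phi> \<in> acarrier A - U"
        using \<Phi> unfolding closedin_alg_top by blast
      then show False using U l by simp
    qed
  qed
next
  let ?X = "acarrier A"
  let ?F = "filter_sets ?X \<Phi>"
  assume l: "limitin (alg_top A) (\<lambda>x. x) l \<Phi>"
  then have lX: "l \<in> ?X" using limitin_topspace topspace_alg_top by metis
  let ?P = "\<lambda>S \<Psi>. ultra_on ?X \<Psi> \<and> alg_lim A \<Psi> = l \<and> eventually (\<lambda>x. x \<in> S) \<Psi>"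
  have "\<forall>S\<in>?F. \<exists>\<Psi>. ?P S \<Psi>"
  proof
    fix S assume S: "S \<in> ?F"
    let ?C = "{alg_lim A \<Psi> | \<Psi>. ultra_on ?X \<Psi> \<and> eventually (\<lambda>x. x \<in> S) \<Psi>}"
    have SX: "S \<subseteq> ?X" "eventually (\<lambda>x. x \<in> S) \<Phi>" using S by (auto simp: filter_sets_def)
    have sub: "x \<in> ?C" if "x \<in> S" for x
    proof -
      have "ultra_on ?X (principal {x})" "alg_lim A (principal {x}) = x"
        using that SX(1) by (auto intro!: ultra_on_principal alg_lim_principal[OF A])
      moreover have "eventually (\<lambda>x. x \<in> S) (principal {x})" using that by (simp add: eventually_principal)
      ultimately show ?thesis by (intro CollectI exI[of _ "principal {x}"]) simp
    qed
    \<comment> \<open>Otherwise the complement of the closed set \<open>?C\<close> would be a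
      neighbourhood of \<open>l\<close> and so belong to \<Phi> together with \<open>S\<close>,
      although \<open>S\<close> is contained in \<open>?C\<close>.\<close>
    have "l \<in> ?C"
    proof (rule ccontr)
      assume n: "l \<notin> ?C"
      have "openin (alg_top A) (?X - ?C)"
        using closedin_alg_lims[OF SX(1)] unfolding closedin_def topspace_alg_top by blast
      then have "eventually (\<lambda>x. x \<in> ?X - ?C) \<Phi>"
        using l lX n unfolding limitin_def by blast
      with SX(2) have "eventually (\<lambda>x. False) \<Phi>" by eventually_elim (use sub in blast)
      then show False using ultra_on_not_bot[OF \<Phi>] by (simp add: trivial_limit_def)
    qed
    then show "\<exists>\<Psi>. ?P S \<Psi>" by auto
  qed
  from bchoice[OF this] obtain \<Psi> where \<Psi>': "\<forall>S\<in>?F. ?P S (\<Psi> S)" ..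
  then have \<Psi>: "ultra_on ?X (\<Psi> S)" and lim: "alg_lim A (\<Psi> S) = l"
    and S: "eventually (\<lambda>x. x \<in> S) (\<Psi> S)" if "S \<in> ?F" for S
    using bspec[OF \<Psi>' that] by iprover+
  have "\<exists>B\<in>?F. \<forall>S\<in>J. B \<subseteq> S" if J: "finite J" "J \<subseteq> ?F" for J
  proof (intro bexI ballI)
    have "eventually (\<lambda>x. \<forall>S\<in>J. x \<in> S) \<Phi>"
      using J by (intro eventually_ball_finite) (auto simp: filter_sets_def)
    with ultra_on_carrier[OF \<Phi>] have "eventually (\<lambda>x. x \<in> ?X \<inter> \<Inter>J) \<Phi>"
      by eventually_elim blast
    then show "?X \<inter> \<Inter>J \<in> ?F" by (simp add: filter_sets_def)
  qed blast
  then obtain G where G: "ultra_on ?F G" and G': "\<And>S. S \<in> ?F \<Longrightarrow> eventually (\<lambda>B. B \<subseteq> S) G"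
    by (rule ex_ultra_on_INF[where P="\<lambda>S B. B \<subseteq> S" and I="?F" and X="?F"]) iprover+
  obtain \<Theta> where \<Theta>: "ultra_on ?X \<Theta>"
    and ev: "\<And>P. eventually P \<Theta> \<longleftrightarrow> eventually (\<lambda>i. eventually P (\<Psi> i)) G"
    by (rule ex_ultra_filter_sum[OF G \<Psi>]) iprover+
  have "\<Theta> = \<Phi>"
  proof (rule ultra_on_le_imp_eq[OF \<Phi> \<Theta>])
    fix P assume P: "eventually P \<Phi>"
    have "eventually (\<lambda>x. x \<in> {x \<in> ?X. P x}) \<Phi>"
      using P ultra_on_carrier[OF \<Phi>] by eventually_elim simp
    then have "{x \<in> ?X. P x} \<in> ?F" by (simp add: filter_sets_def)
    from G'[OF this] ultra_on_carrier[OF G] have "eventually (\<lambda>B. eventually P (\<Psi> B)) G"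
    proof eventually_elim
      case (elim B)
      from S[OF elim(2)] show ?case by (rule eventually_mono) (use elim(1) in blast)
    qed
    then show "eventually P \<Theta>" by (simp add: ev)
  qed
  moreover have "filtermap (\<lambda>B. alg_lim A (\<Psi> B)) G = principal {l}"
    by (rule filtermap_eventually_const[OF ultra_on_not_bot[OF G]])
      (use ultra_on_carrier[OF G] lim in \<open>auto elim: eventually_mono\<close>)
  ultimately show "l = alg_lim A \<Phi>"
    using alg_lim_sum[OF A G \<Psi> \<Theta> ev] alg_lim_principal[OF A lX] by simp
qed

text \<open>Limits of ultrafilters are the values of the function \<open>alg_lim\<close>: they are
  unique, which is used here, and they exist, which gives compactness.\<close>

lemma Hausdorff_alg_top: "Hausdorff_space (alg_top A)"
  by (rule Hausdorff_space_ultraI) (simp add: topspace_alg_top limitin_alg_top)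

lemma compact_alg_top: "compact_space (alg_top A)"
  by (rule compact_space_ultraI) (simp add: topspace_alg_top limitin_alg_top)

section \<open>The convex structure of an algebra\<close>

lemma astruct_dist_closed: "\<phi> \<in> Dist (acarrier A) \<Longrightarrow> astruct A (dist_to_exp (acarrier A) \<phi>) \<in> acarrier A"
  by (intro exp_alg_closed[OF A] dist_to_exp_in_Exp)

lemma is_convex_structure_exp_alg: "is_convex_structure (acarrier A) (cconv (exp_alg_to_cch A))"
  unfolding is_convex_structure_def cconv_exp_alg_to_cch
proof (intro conjI ballI)
  let ?X = "acarrier A"
  let ?\<sigma> = "dist_to_exp ?X"
  let ?c = "\<lambda>\<phi>\<in>Dist ?X. astruct A (?\<sigma> \<phi>)"
  show "?c \<in> Dist ?X \<rightarrow>\<^sub>E ?X" using astruct_dist_closed by auto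
  show "?c (return_pmf x) = x" if x: "x \<in> ?X" for x
  proof -
    have "return_pmf x \<in> Dist ?X" using x by (simp add: Dist_def)
    then show ?thesis using x by (simp add: dist_to_exp_return exp_alg_unit[OF A])
  qed
  fix \<Phi> assume \<Phi>: "\<Phi> \<in> Dist (Dist ?X)"
  \<comment> \<open>The multiplication law of the algebra at \<open>H\<close> is the convexity law
    at \<Phi>, because \<sigma> respects multiplication and is natural.\<close>
  define H where "H = dist_to_exp (Exp ?X) (map_pmf ?\<sigma> \<Phi>)"
  have \<sigma>\<Phi>: "map_pmf ?\<sigma> \<Phi> \<in> Dist (Exp ?X)" using \<Phi> dist_to_exp_in_Exp by (rule map_pmf_Dist)
  have H: "H \<in> Exp (Exp ?X)" unfolding H_def using \<sigma>\<Phi> by (rule dist_to_exp_in_Exp)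
  have join: "join_pmf \<Phi> \<in> Dist ?X" using \<Phi> by (rule join_pmf_Dist)
  have supp: "\<psi> \<in> Dist ?X" if "\<psi> \<in> set_pmf \<Phi>" for \<psi> using \<Phi> that by (auto simp: Dist_def)
  have "Exp_mult ?X H = ?\<sigma> (join_pmf \<Phi>)"
  proof (rule Exp_eqI[OF Exp_mult_in_Exp[OF H] dist_to_exp_in_Exp[OF join]])
    fix p assume p: "p \<in> preds ?X"
    let ?e = "\<lambda>k\<in>Exp ?X. k p"
    have e: "?e \<in> preds (Exp ?X)" using p by (rule Exp_pred_in_preds)
    have e\<sigma>: "(\<lambda>\<psi>\<in>Dist ?X. ?e (?\<sigma> \<psi>)) \<in> preds (Dist ?X)" using e dist_to_exp_in_Exp by (rule preds_compose)
    have "H = Exp_map (Dist ?X) (Exp ?X) ?\<sigma> (dist_to_exp (Dist ?X) \<Phi>)"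
      unfolding H_def by (rule dist_to_exp_map[OF \<Phi> dist_to_exp_in_Exp])
    then have "H ?e = dist_to_exp (Dist ?X) \<Phi> (\<lambda>\<psi>\<in>Dist ?X. ?e (?\<sigma> \<psi>))"
      unfolding Exp_map_def by (simp only: restrict_apply'[OF e])
    also have "\<dots> = (\<Sum>\<psi>\<in>set_pmf \<Phi>. pmf \<Phi> \<psi> * ?\<sigma> \<psi> p)"
      using e\<sigma> supp by (simp add: dist_to_exp_def[of "Dist ?X"] dist_to_exp_in_Exp)
    also have "\<dots> = ?\<sigma> (join_pmf \<Phi>) p" using dist_to_exp_join[OF \<Phi> p] by simp
    finally show "Exp_mult ?X H p = ?\<sigma> (join_pmf \<Phi>) p" using p by (simp add: Exp_mult_def)
  qed
  moreover have "Exp_map (Exp ?X) ?X (astruct A) H = ?\<sigma> (map_pmf ?c \<Phi>)"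
  proof -
    have "Exp_map (Exp ?X) ?X (astruct A) H = ?\<sigma> (map_pmf (astruct A) (map_pmf ?\<sigma> \<Phi>))"
      unfolding H_def using dist_to_exp_map[OF \<sigma>\<Phi> exp_alg_closed[OF A]] by simp
    also have "map_pmf (astruct A) (map_pmf ?\<sigma> \<Phi>) = map_pmf ?c \<Phi>"
      unfolding map_pmf_comp using supp by (intro map_pmf_cong refl) simp
    finally show ?thesis .
  qed
  moreover have "map_pmf ?c \<Phi> \<in> Dist ?X"
    using \<Phi> astruct_dist_closed by (intro map_pmf_Dist) auto
  ultimately show "?c (join_pmf \<Phi>) = ?c (map_pmf ?c \<Phi>)"
    using exp_alg_mult[OF A H] join by simp
qed

lemma is_cch_exp_alg: "is_cch (exp_alg_to_cch A)"
  unfolding is_cch_def ccarrier_exp_alg_to_cch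
  using is_convex_structure_exp_alg topspace_alg_top compact_alg_top Hausdorff_alg_top
  by (simp add: alg_top_def)

end

section \<open>Affine continuous maps and homomorphisms of algebras\<close>

text \<open>Ultrafilter limits determine the topology, so continuity is preservation of
  \<open>alg_lim\<close>. In this form both conditions are, by naturality of \<sigma> and \<tau>,
  the homomorphism equation at expectations that come from distributions and from
  ultrafilters.\<close>

lemma cch_hom_exp_alg_iff:
  assumes A: "is_exp_alg A" and B: "is_exp_alg B"
  shows "f \<in> cch_hom (exp_alg_to_cch A) (exp_alg_to_cch B) \<longleftrightarrow>
    f \<in> acarrier A \<rightarrow>\<^sub>E acarrier B \<and>
    (\<forall>\<phi>\<in>Dist (acarrier A). f (astruct A (dist_to_exp (acarrier A) \<phi>)) =
       astruct B (dist_to_exp (acarrier B) (map_pmf f \<phi>))) \<and>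
    (\<forall>\<Phi>. ultra_on (acarrier A) \<Phi> \<longrightarrow> f (alg_lim A \<Phi>) = alg_lim B (filtermap f \<Phi>))"
proof -
  have "continuous_map (alg_top A) (alg_top B) f \<longleftrightarrow>
    (\<forall>\<Phi>. ultra_on (acarrier A) \<Phi> \<longrightarrow> f (alg_lim A \<Phi>) = alg_lim B (filtermap f \<Phi>))"
    if f: "f \<in> acarrier A \<rightarrow>\<^sub>E acarrier B"
  proof (intro iffI allI impI)
    fix \<Phi> assume c: "continuous_map (alg_top A) (alg_top B) f" and \<Phi>: "ultra_on (acarrier A) \<Phi>"
    have f\<Phi>: "ultra_on (acarrier B) (filtermap f \<Phi>)" using \<Phi> PiE_mem[OF f] by (rule ultra_on_filtermap)
    have "limitin (alg_top B) (f \<circ> (\<lambda>x. x)) (f (alg_lim A \<Phi>)) \<Phi>"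
      using c limitin_alg_top[OF A \<Phi>] by (intro continuous_map_limit) auto
    then have "limitin (alg_top B) (\<lambda>x. x) (f (alg_lim A \<Phi>)) (filtermap f \<Phi>)"
      unfolding limitin_filtermap_ident by (simp add: o_def)
    then show "f (alg_lim A \<Phi>) = alg_lim B (filtermap f \<Phi>)"
      using limitin_alg_top[OF B f\<Phi>] by simp
  next
    assume lim: "\<forall>\<Phi>. ultra_on (acarrier A) \<Phi> \<longrightarrow> f (alg_lim A \<Phi>) = alg_lim B (filtermap f \<Phi>)"
    show "continuous_map (alg_top A) (alg_top B) f"
      unfolding continuous_map_closedin topspace_alg_top[OF A] topspace_alg_top[OF B]
    proof (intro conjI allI impI)
      show "f \<in> acarrier A \<rightarrow> acarrier B" using f by (simp add: PiE_def)
      fix C assume C: "closedin (alg_top B) C"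
      show "closedin (alg_top A) {x \<in> acarrier A. f x \<in> C}"
        unfolding closedin_alg_top[OF A]
      proof (intro conjI allI impI)
        show "{x \<in> acarrier A. f x \<in> C} \<subseteq> acarrier A" by blast
        fix \<Phi> assume "ultra_on (acarrier A) \<Phi> \<and> eventually (\<lambda>x. x \<in> {x \<in> acarrier A. f x \<in> C}) \<Phi>"
        then have \<Phi>: "ultra_on (acarrier A) \<Phi>"
          and "eventually (\<lambda>x. x \<in> {x \<in> acarrier A. f x \<in> C}) \<Phi>" by blast+
        then have "eventually (\<lambda>x. x \<in> C) (filtermap f \<Phi>)"
          unfolding eventually_filtermap by (auto elim: eventually_mono)
        moreover have "ultra_on (acarrier B) (filtermap f \<Phi>)"
          using \<Phi> PiE_mem[OF f] by (rule ultra_on_filtermap)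
        ultimately have "alg_lim B (filtermap f \<Phi>) \<in> C"
          using C unfolding closedin_alg_top[OF B] by blast
        then show "alg_lim A \<Phi> \<in> {x \<in> acarrier A. f x \<in> C}"
          using lim \<Phi> alg_lim_closed[OF A \<Phi>] by simp
      qed
    qed
  qed
  moreover have "(\<forall>\<phi>\<in>Dist (acarrier A). f (cconv (exp_alg_to_cch A) \<phi>) = cconv (exp_alg_to_cch B) (map_pmf f \<phi>)) \<longleftrightarrow>
    (\<forall>\<phi>\<in>Dist (acarrier A). f (astruct A (dist_to_exp (acarrier A) \<phi>)) =
       astruct B (dist_to_exp (acarrier B) (map_pmf f \<phi>)))"
    if f: "f \<in> acarrier A \<rightarrow>\<^sub>E acarrier B"
    using map_pmf_Dist[of _ "acarrier A" f "acarrier B"] PiE_mem[OF f]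
    by (simp add: cconv_exp_alg_to_cch)
  ultimately show ?thesis
    unfolding cch_hom_def mem_Collect_eq ccarrier_exp_alg_to_cch alg_top_def
    by (intro conj_cong refl) blast+
qed

text \<open>Both \<open>f \<circ> \<alpha>\<close> and \<open>\<beta> \<circ> Exp_map f\<close> preserve ultrafilter limits and they agree on the
  distributions, which are dense in \<^const>\<open>Exp\<close>.\<close>

lemma cch_hom_exp_alg:
  assumes A: "is_exp_alg A" and B: "is_exp_alg B"
  shows "cch_hom (exp_alg_to_cch A) (exp_alg_to_cch B) = exp_alg_hom A B"
proof (intro set_eqI iffI)
  let ?X = "acarrier A" and ?Y = "acarrier B"
  fix f assume f: "f \<in> exp_alg_hom A B"
  then have fXY: "f \<in> ?X \<rightarrow>\<^sub>E ?Y"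
    and hom: "\<And>h. h \<in> Exp ?X \<Longrightarrow> f (astruct A h) = astruct B (Exp_map ?X ?Y f h)"
    by (auto simp: exp_alg_hom_def)
  note fin = PiE_mem[OF fXY]
  show "f \<in> cch_hom (exp_alg_to_cch A) (exp_alg_to_cch B)"
    unfolding cch_hom_exp_alg_iff[OF A B]
  proof (intro conjI ballI allI impI fXY)
    fix \<phi> assume \<phi>: "\<phi> \<in> Dist ?X"
    show "f (astruct A (dist_to_exp ?X \<phi>)) = astruct B (dist_to_exp ?Y (map_pmf f \<phi>))"
      by (simp add: hom dist_to_exp_in_Exp \<phi> dist_to_exp_map[OF \<phi> fin])
  next
    fix \<Phi> assume \<Phi>: "ultra_on ?X \<Phi>"
    show "f (alg_lim A \<Phi>) = alg_lim B (filtermap f \<Phi>)"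
      unfolding alg_lim_def by (simp add: hom uf_to_exp_in_Exp \<Phi> uf_to_exp_filtermap[OF \<Phi> fin])
  qed
next
  let ?X = "acarrier A" and ?Y = "acarrier B"
  fix f assume "f \<in> cch_hom (exp_alg_to_cch A) (exp_alg_to_cch B)"
  then have fXY: "f \<in> ?X \<rightarrow>\<^sub>E ?Y"
    and affine: "\<And>\<phi>. \<phi> \<in> Dist ?X \<Longrightarrow>
      f (astruct A (dist_to_exp ?X \<phi>)) = astruct B (dist_to_exp ?Y (map_pmf f \<phi>))"
    and cont: "\<And>\<Phi>. ultra_on ?X \<Phi> \<Longrightarrow> f (alg_lim A \<Phi>) = alg_lim B (filtermap f \<Phi>)"
    unfolding cch_hom_exp_alg_iff[OF A B] by blast+
  note fin = PiE_mem[OF fXY]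
  have "f (astruct A h) = astruct B (Exp_map ?X ?Y f h)" if h: "h \<in> Exp ?X" for h
  proof -
    obtain W where W: "ultra_on (Dist ?X) W"
      and lim: "\<And>p. p \<in> preds ?X \<Longrightarrow> ((\<lambda>\<phi>. dist_to_exp ?X \<phi> p) \<longlongrightarrow> h p) W"
      using Exp_ultra_limit[OF h] by metis
    let ?c = "\<lambda>\<phi>. astruct A (dist_to_exp ?X \<phi>)"
    have cW: "ultra_on ?X (filtermap ?c W)"
      using W astruct_dist_closed[OF A] by (rule ultra_on_filtermap)
    have "astruct A h = alg_lim A (filtermap ?c W)"
      by (rule astruct_limit[OF A W dist_to_exp_in_Exp h lim])
    then have "f (astruct A h) = alg_lim B (filtermap f (filtermap ?c W))"
      using cont[OF cW] by simp
    also have "\<dots> = alg_lim B (filtermap (\<lambda>\<phi>. astruct B (Exp_map ?X ?Y f (dist_to_exp ?X \<phi>))) W)"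
      unfolding filtermap_filtermap
    proof (intro arg_cong[of _ _ "alg_lim B"] filtermap_eventually_cong)
      show "eventually (\<lambda>\<phi>. f (?c \<phi>) = astruct B (Exp_map ?X ?Y f (dist_to_exp ?X \<phi>))) W"
        using ultra_on_carrier[OF W]
        by eventually_elim (simp add: affine dist_to_exp_map[OF _ fin])
    qed
    also have "\<dots> = astruct B (Exp_map ?X ?Y f h)"
    proof (rule astruct_limit[OF B W, symmetric])
      show "Exp_map ?X ?Y f (dist_to_exp ?X \<phi>) \<in> Exp ?Y" if "\<phi> \<in> Dist ?X" for \<phi>
        by (rule Exp_map_in_Exp[OF dist_to_exp_in_Exp[OF that] fin])
      show "Exp_map ?X ?Y f h \<in> Exp ?Y" by (rule Exp_map_in_Exp[OF h fin])
      show "((\<lambda>\<phi>. Exp_map ?X ?Y f (dist_to_exp ?X \<phi>) p) \<longlongrightarrow> Exp_map ?X ?Y f h p) W"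
        if "p \<in> preds ?Y" for p
        using lim[OF preds_compose[OF that fin]] that by (simp add: Exp_map_def)
    qed
    finally show ?thesis .
  qed
  with fXY show "f \<in> exp_alg_hom A B" by (simp add: exp_alg_hom_def)
qed

section \<open>Recovering an algebra from an observable space\<close>

text \<open>The mean of a measure on [0,1]. It induces the usual convexity and topology of the
  interval (\<open>exp_alg_to_cch_unit\<close>), so that affine continuous maps from an algebra to
  [0,1] are homomorphisms.\<close>

definition unit_exp_alg :: "real exp_alg" where
  "unit_exp_alg = \<lparr>acarrier = {0..1}, astruct = (\<lambda>h\<in>Exp {0..1}. h (\<lambda>x\<in>{0..1}. x))\<rparr>"

lemma ident_in_preds: "(\<lambda>x\<in>{0..1}. x) \<in> preds {0..1}"
  by auto

lemma is_exp_alg_unit: "is_exp_alg unit_exp_alg"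
proof -
  let ?I = "{0..1::real}"
  let ?\<alpha> = "\<lambda>h\<in>Exp ?I. h (\<lambda>x\<in>?I. x)"
  have \<alpha>: "?\<alpha> h \<in> ?I" if "h \<in> Exp ?I" for h
    using Exp_range[OF that ident_in_preds] that by simp
  have "?\<alpha> (Exp_unit ?I x) = x" if "x \<in> ?I" for x
  proof -
    have "Exp_unit ?I x (\<lambda>x\<in>?I. x) = x"
      using that by (simp only: Exp_unit_apply[OF ident_in_preds] restrict_apply')
    then show ?thesis using Exp_unit_in_Exp[OF that] by simp
  qed
  moreover have "?\<alpha> (Exp_mult ?I h) = ?\<alpha> (Exp_map (Exp ?I) ?I ?\<alpha> h)" if h: "h \<in> Exp (Exp ?I)" for h
  proof -
    have "?\<alpha> (Exp_map (Exp ?I) ?I ?\<alpha> h) = Exp_map (Exp ?I) ?I ?\<alpha> h (\<lambda>x\<in>?I. x)"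
      using Exp_map_in_Exp[OF h \<alpha>] by (rule restrict_apply')
    also have "\<dots> = h (\<lambda>k\<in>Exp ?I. (\<lambda>x\<in>?I. x) (?\<alpha> k))"
      by (rule Exp_map_apply[OF ident_in_preds])
    also have "(\<lambda>k\<in>Exp ?I. (\<lambda>x\<in>?I. x) (?\<alpha> k)) = (\<lambda>k\<in>Exp ?I. k (\<lambda>x\<in>?I. x))"
      using \<alpha> by (intro restrict_ext) (simp only: restrict_apply')
    also have "h \<dots> = Exp_mult ?I h (\<lambda>x\<in>?I. x)"
      by (rule Exp_mult_apply[OF ident_in_preds, symmetric])
    also have "\<dots> = ?\<alpha> (Exp_mult ?I h)"
      using Exp_mult_in_Exp[OF h] by (rule restrict_apply'[symmetric])
    finally show ?thesis by (rule sym)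
  qed
  moreover have "?\<alpha> \<in> Exp ?I \<rightarrow>\<^sub>E ?I"
  proof (rule PiE_I)
    show "?\<alpha> h \<in> ?I" if "h \<in> Exp ?I" for h using that by (rule \<alpha>)
  qed (rule restrict_apply[THEN trans], rule if_not_P)
  ultimately show ?thesis
    unfolding is_exp_alg_def Let_def unit_exp_alg_def exp_alg.simps by (intro conjI ballI)
qed

lemma cconv_unit_cch:
  assumes "\<phi> \<in> Dist {0..1}"
  shows "cconv unit_cch \<phi> = dist_to_exp {0..1} \<phi> (\<lambda>x\<in>{0..1}. x)"
proof -
  have "dist_to_exp {0..1} \<phi> (\<lambda>x\<in>{0..1}. x) = (\<Sum>x\<in>set_pmf \<phi>. pmf \<phi> x * (\<lambda>x\<in>{0..1}. x) x)"
    by (rule dist_to_exp_apply[OF ident_in_preds])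
  also have "\<dots> = (\<Sum>x\<in>set_pmf \<phi>. pmf \<phi> x * x)"
    using assms by (intro sum.cong refl) (auto simp: Dist_def)
  finally show ?thesis using assms by (simp add: unit_cch_def)
qed

lemma exp_alg_to_cch_unit: "exp_alg_to_cch unit_exp_alg = unit_cch"
proof -
  let ?I = "{0..1::real}"
  have carrier: "acarrier unit_exp_alg = ?I" by (simp add: unit_exp_alg_def)
  have struct: "astruct unit_exp_alg h = h (\<lambda>x\<in>?I. x)" if "h \<in> Exp ?I" for h
    using that by (simp add: unit_exp_alg_def)
  have "cconv (exp_alg_to_cch unit_exp_alg) = (\<lambda>\<phi>\<in>Dist ?I. cconv unit_cch \<phi>)"
    unfolding cconv_exp_alg_to_cch carrier
    by (intro restrict_ext) (simp add: struct dist_to_exp_in_Exp cconv_unit_cch)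
  also have "\<dots> = cconv unit_cch"
    unfolding unit_cch_def cch.simps by (rule restrict_ext) (rule restrict_apply')
  finally have conv: "cconv (exp_alg_to_cch unit_exp_alg) = cconv unit_cch" .
  have "uf_topology (topspace (top_of_set ?I)) (\<lambda>F. astruct unit_exp_alg (uf_to_exp ?I F)) = top_of_set ?I"
  proof (rule uf_topology_eq)
    show "Hausdorff_space (top_of_set ?I)" by (simp add: Hausdorff_space_subtopology)
    fix \<Phi> assume "ultra_on (topspace (top_of_set ?I)) \<Phi>"
    then have \<Phi>: "ultra_on ?I \<Phi>" by simp
    let ?l = "uf_to_exp ?I (filter_sets ?I \<Phi>) (\<lambda>x\<in>?I. x)"
    have "((\<lambda>x\<in>?I. x) \<longlongrightarrow> ?l) \<Phi>" using \<Phi> ident_in_preds by (rule tendsto_uf_to_exp)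
    then have "((\<lambda>x. x) \<longlongrightarrow> ?l) \<Phi>"
      by (rule tendsto_eventually_cong) (use ultra_on_carrier[OF \<Phi>] in \<open>auto elim: eventually_mono\<close>)
    moreover have "?l \<in> ?I" using Exp_range[OF uf_to_exp_in_Exp[OF \<Phi>] ident_in_preds] by simp
    ultimately show "limitin (top_of_set ?I) (\<lambda>x. x)
      (astruct unit_exp_alg (uf_to_exp ?I (filter_sets (topspace (top_of_set ?I)) \<Phi>))) \<Phi>"
      using ultra_on_carrier[OF \<Phi>] struct[OF uf_to_exp_in_Exp[OF \<Phi>]]
      by (simp only: topspace_euclidean_subtopology limitin_subtopology limitin_canonical_iff simp_thms)
  qed
  then have "ctop (exp_alg_to_cch unit_exp_alg) = ctop unit_cch"
    by (simp add: exp_alg_to_cch_def Let_def carrier unit_cch_def)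
  with conv carrier show ?thesis
    by (intro cch.equality) (simp_all add: ccarrier_exp_alg_to_cch, simp_all add: unit_cch_def)
qed

lemma cch_hom_unit_preds: "q \<in> cch_hom Y unit_cch \<Longrightarrow> q \<in> preds (ccarrier Y)"
  by (simp add: cch_hom_def unit_cch_def)

text \<open>The map \<open>q\<close> is a homomorphism into the interval algebra, and pushing
  \<open>h\<close> forward along \<open>q\<close> and evaluating at the identity predicate gives
  \<open>h q\<close>. This is the origin of the barycenter equation.\<close>

lemma cch_hom_unit_astruct:
  assumes A: "is_exp_alg A" and q: "q \<in> cch_hom (exp_alg_to_cch A) unit_cch" and h: "h \<in> Exp (acarrier A)"
  shows "q (astruct A h) = h q"
proof -
  let ?X = "acarrier A" and ?I = "{0..1::real}"
  have qX: "q \<in> preds ?X" using cch_hom_unit_preds[OF q] by (simp add: ccarrier_exp_alg_to_cch)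
  note q' = PiE_mem[OF qX]
  have "q \<in> exp_alg_hom A unit_exp_alg"
    using q by (simp add: cch_hom_exp_alg[OF A is_exp_alg_unit, symmetric] exp_alg_to_cch_unit)
  then have "q (astruct A h) = (\<lambda>h\<in>Exp ?I. h (\<lambda>x\<in>?I. x)) (Exp_map ?X ?I q h)"
    using h by (simp add: exp_alg_hom_def unit_exp_alg_def)
  also have "\<dots> = Exp_map ?X ?I q h (\<lambda>x\<in>?I. x)"
    by (rule restrict_apply'[OF Exp_map_in_Exp[OF h q']])
  also have "\<dots> = h (\<lambda>x\<in>?X. (\<lambda>x\<in>?I. x) (q x))"
    by (rule Exp_map_apply[OF ident_in_preds])
  also have "(\<lambda>x\<in>?X. (\<lambda>x\<in>?I. x) (q x)) = q"
    using qX q' by (intro preds_eqI[of _ ?X] preds_compose[OF ident_in_preds]) auto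
  finally show ?thesis .
qed

section \<open>Barycenters in an observable space\<close>

text \<open>The description is proper for observable compact spaces, by \<open>ex_barycenter\<close>
  and \<open>observable_unique\<close>. The restriction to \<open>Exp\<close> makes the structure
  map extensional, so that algebras are recovered up to equality.\<close>

definition obs_alg :: "'a cch \<Rightarrow> 'a exp_alg" where
  "obs_alg Y = \<lparr>acarrier = ccarrier Y,
     astruct = (\<lambda>h\<in>Exp (ccarrier Y).
       THE x. x \<in> ccarrier Y \<and> (\<forall>q\<in>cch_hom Y unit_cch. q x = h q))\<rparr>"

lemma cch_hom_unit_cconv:
  assumes Y: "is_cch Y" and q: "q \<in> cch_hom Y unit_cch" and \<phi>: "\<phi> \<in> Dist (ccarrier Y)"
  shows "q (cconv Y \<phi>) = dist_to_exp (ccarrier Y) \<phi> q"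
proof -
  let ?X = "ccarrier Y" and ?I = "{0..1::real}"
  have qX: "q \<in> preds ?X" using q by (rule cch_hom_unit_preds)
  note q' = PiE_mem[OF qX]
  have "q (cconv Y \<phi>) = cconv unit_cch (map_pmf q \<phi>)"
    using q \<phi> by (simp add: cch_hom_def)
  also have "\<dots> = dist_to_exp ?I (map_pmf q \<phi>) (\<lambda>x\<in>?I. x)"
    using map_pmf_Dist[OF \<phi> q'] by (rule cconv_unit_cch)
  also have "dist_to_exp ?I (map_pmf q \<phi>) = Exp_map ?X ?I q (dist_to_exp ?X \<phi>)"
    using \<phi> q' by (rule dist_to_exp_map)
  also have "\<dots> (\<lambda>x\<in>?I. x) = dist_to_exp ?X \<phi> (\<lambda>x\<in>?X. (\<lambda>x\<in>?I. x) (q x))"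
    by (rule Exp_map_apply[OF ident_in_preds])
  also have "(\<lambda>x\<in>?X. (\<lambda>x\<in>?I. x) (q x)) = q"
    using qX q' by (intro preds_eqI[of _ ?X] preds_compose[OF ident_in_preds]) auto
  finally show ?thesis .
qed

lemma cch_hom_unit_limit:
  assumes q: "q \<in> cch_hom Y unit_cch" and l: "limitin (ctop Y) (\<lambda>x. x) l \<Phi>"
  shows "(q \<longlongrightarrow> q l) \<Phi>"
proof -
  have "limitin (top_of_set {0..1}) (q \<circ> (\<lambda>x. x)) (q l) \<Phi>"
    using q by (intro continuous_map_limit[OF _ l]) (simp add: cch_hom_def unit_cch_def)
  then show ?thesis by (simp add: limitin_subtopology o_def)
qed

context
  fixes Y :: "'a cch"
  assumes Y: "is_cch Y" and obs: "observable_cch Y"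
begin

lemma observable_unique:
  "x \<in> ccarrier Y \<Longrightarrow> x' \<in> ccarrier Y \<Longrightarrow> (\<And>q. q \<in> cch_hom Y unit_cch \<Longrightarrow> q x = q x') \<Longrightarrow> x = x'"
  using obs unfolding observable_cch_def by blast

lemma cch_topspace: "topspace (ctop Y) = ccarrier Y"
  using Y by (simp add: is_cch_def)

lemma cch_cconv_closed: "\<phi> \<in> Dist (ccarrier Y) \<Longrightarrow> cconv Y \<phi> \<in> ccarrier Y"
  using Y unfolding is_cch_def is_convex_structure_def by (auto dest: PiE_mem)

text \<open>One limit point \<open>l\<close> serves all \<open>q\<close> at once. By continuity
  \<open>q l\<close> is the limit of \<open>q (cconv Y \<phi>)\<close>; by affineness these numbers
  are the values at \<open>q\<close> of the approximating distributions, and those tend to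
  \<open>h q\<close>.\<close>

lemma ex_barycenter:
  assumes h: "h \<in> Exp (ccarrier Y)"
  shows "\<exists>x\<in>ccarrier Y. \<forall>q\<in>cch_hom Y unit_cch. q x = h q"
proof -
  let ?X = "ccarrier Y"
  obtain W where W: "ultra_on (Dist ?X) W"
    and lim: "\<And>p. p \<in> preds ?X \<Longrightarrow> ((\<lambda>\<phi>. dist_to_exp ?X \<phi> p) \<longlongrightarrow> h p) W"
    using Exp_ultra_limit[OF h] by metis
  have "ultra_on (topspace (ctop Y)) (filtermap (cconv Y) W)"
    unfolding cch_topspace using W cch_cconv_closed by (rule ultra_on_filtermap)
  moreover have "compact_space (ctop Y)" using Y by (simp add: is_cch_def)
  ultimately obtain l where l: "limitin (ctop Y) (\<lambda>x. x) l (filtermap (cconv Y) W)"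
    using compact_space_ultra_limit by metis
  show ?thesis
  proof (intro bexI ballI)
    show "l \<in> ?X" using limitin_topspace[OF l] by (simp add: cch_topspace)
    fix q assume q: "q \<in> cch_hom Y unit_cch"
    have "((\<lambda>\<phi>. q (cconv Y \<phi>)) \<longlongrightarrow> q l) W"
      using cch_hom_unit_limit[OF q l] by (simp add: filterlim_filtermap)
    then have "((\<lambda>\<phi>. dist_to_exp ?X \<phi> q) \<longlongrightarrow> q l) W"
    proof (rule tendsto_eventually_cong)
      show "eventually (\<lambda>\<phi>. q (cconv Y \<phi>) = dist_to_exp ?X \<phi> q) W"
        using ultra_on_carrier[OF W] by eventually_elim (rule cch_hom_unit_cconv[OF Y q])
    qed
    from tendsto_unique[OF ultra_on_not_bot[OF W] this lim[OF cch_hom_unit_preds[OF q]]]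
    show "q l = h q" .
  qed
qed

lemma acarrier_obs_alg: "acarrier (obs_alg Y) = ccarrier Y"
  by (simp add: obs_alg_def)

lemma astruct_obs_alg:
  assumes h: "h \<in> Exp (ccarrier Y)"
  shows "astruct (obs_alg Y) h \<in> ccarrier Y"
    and "q \<in> cch_hom Y unit_cch \<Longrightarrow> q (astruct (obs_alg Y) h) = h q"
proof -
  let ?P = "\<lambda>x. x \<in> ccarrier Y \<and> (\<forall>q\<in>cch_hom Y unit_cch. q x = h q)"
  obtain x where x: "?P x" using ex_barycenter[OF h] by blast
  have eq: "astruct (obs_alg Y) h = (THE x. ?P x)" using h by (simp add: obs_alg_def)
  have "?P (THE x. ?P x)"
  proof (rule theI)
    show "x' = x" if "?P x'" for x'
      using that x by (intro observable_unique) auto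
  qed (rule x)
  then have P: "?P (astruct (obs_alg Y) h)" unfolding eq .
  from P show "astruct (obs_alg Y) h \<in> ccarrier Y" by (rule conjunct1)
  from P show "q \<in> cch_hom Y unit_cch \<Longrightarrow> q (astruct (obs_alg Y) h) = h q" by (rule bspec[OF conjunct2])
qed

text \<open>Identities in the reconstructed algebra are checked by testing with every
  \<open>q\<close>.\<close>

lemma astruct_obs_alg_eqI:
  "h \<in> Exp (ccarrier Y) \<Longrightarrow> x \<in> ccarrier Y \<Longrightarrow> (\<And>q. q \<in> cch_hom Y unit_cch \<Longrightarrow> q x = h q) \<Longrightarrow>
    astruct (obs_alg Y) h = x"
  by (rule observable_unique) (simp_all add: astruct_obs_alg)

text \<open>Each test \<open>q\<close> gives both sides of a law the same value: \<open>q x\<close>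
  for the unit law, and for the multiplication law the value of \<open>h\<close> at the predicate
  that sends an expectation \<open>k\<close> to \<open>k q\<close>.\<close>

lemma is_exp_alg_obs_alg: "is_exp_alg (obs_alg Y)"
  unfolding is_exp_alg_def Let_def acarrier_obs_alg
proof (intro conjI ballI)
  let ?X = "ccarrier Y" and ?\<alpha> = "astruct (obs_alg Y)"
  show "?\<alpha> \<in> Exp ?X \<rightarrow>\<^sub>E ?X"
    using astruct_obs_alg(1) by (auto simp: obs_alg_def)
  show "?\<alpha> (Exp_unit ?X x) = x" if x: "x \<in> ?X" for x
    by (intro astruct_obs_alg_eqI Exp_unit_in_Exp x) (simp add: Exp_unit_apply[OF cch_hom_unit_preds])
  fix h assume h: "h \<in> Exp (Exp ?X)"
  note \<alpha>h = Exp_map_in_Exp[OF h astruct_obs_alg(1)]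
  show "?\<alpha> (Exp_mult ?X h) = ?\<alpha> (Exp_map (Exp ?X) ?X ?\<alpha> h)"
  proof (intro astruct_obs_alg_eqI Exp_mult_in_Exp h astruct_obs_alg(1) \<alpha>h)
    fix q assume q: "q \<in> cch_hom Y unit_cch"
    note qX = cch_hom_unit_preds[OF q]
    have "q (?\<alpha> (Exp_map (Exp ?X) ?X ?\<alpha> h)) = Exp_map (Exp ?X) ?X ?\<alpha> h q"
      by (rule astruct_obs_alg(2)[OF \<alpha>h q])
    also have "\<dots> = h (\<lambda>k\<in>Exp ?X. q (?\<alpha> k))"
      by (rule Exp_map_apply[OF qX])
    also have "(\<lambda>k\<in>Exp ?X. q (?\<alpha> k)) = (\<lambda>k\<in>Exp ?X. k q)"
      by (rule restrict_ext) (rule astruct_obs_alg(2)[OF _ q])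
    also have "h \<dots> = Exp_mult ?X h q"
      by (rule Exp_mult_apply[OF qX, symmetric])
    finally show "q (?\<alpha> (Exp_map (Exp ?X) ?X ?\<alpha> h)) = Exp_mult ?X h q" .
  qed
qed

text \<open>For an expectation that comes from a distribution the barycenter equations express
  affineness of the tests, so \<open>cconv\<close> solves them; for one that comes from an
  ultrafilter they express continuity, so the topological limit does.\<close>

lemma exp_alg_to_cch_obs_alg: "exp_alg_to_cch (obs_alg Y) = Y"
proof -
  let ?X = "ccarrier Y" and ?\<alpha> = "astruct (obs_alg Y)"
  have "cconv (exp_alg_to_cch (obs_alg Y)) = cconv Y"
  proof (rule PiE_ext)
    show "cconv (exp_alg_to_cch (obs_alg Y)) \<in> Dist ?X \<rightarrow>\<^sub>E ?X"
      using is_convex_structure_exp_alg[OF is_exp_alg_obs_alg]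
      by (simp add: is_convex_structure_def acarrier_obs_alg)
    show "cconv Y \<in> Dist ?X \<rightarrow>\<^sub>E ?X"
      using Y by (simp add: is_cch_def is_convex_structure_def)
    fix \<phi> assume \<phi>: "\<phi> \<in> Dist ?X"
    have "?\<alpha> (dist_to_exp ?X \<phi>) = cconv Y \<phi>"
      by (intro astruct_obs_alg_eqI dist_to_exp_in_Exp cch_cconv_closed cch_hom_unit_cconv[OF Y] \<phi>)
    then show "cconv (exp_alg_to_cch (obs_alg Y)) \<phi> = cconv Y \<phi>"
      using \<phi> by (simp add: cconv_exp_alg_to_cch acarrier_obs_alg)
  qed
  moreover have "uf_topology (topspace (ctop Y)) (\<lambda>F. ?\<alpha> (uf_to_exp ?X F)) = ctop Y"
  proof (rule uf_topology_eq)
    show "Hausdorff_space (ctop Y)" using Y by (simp add: is_cch_def)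
    fix \<Phi> assume \<Phi>: "ultra_on (topspace (ctop Y)) \<Phi>"
    then have \<Phi>X: "ultra_on ?X \<Phi>" by (simp add: cch_topspace)
    have "compact_space (ctop Y)" using Y by (simp add: is_cch_def)
    then obtain l where l: "limitin (ctop Y) (\<lambda>x. x) l \<Phi>"
      using \<Phi> by (rule compact_space_ultra_limit)
    have "?\<alpha> (uf_to_exp ?X (filter_sets ?X \<Phi>)) = l"
    proof (intro astruct_obs_alg_eqI uf_to_exp_in_Exp \<Phi>X)
      show "l \<in> ?X" using limitin_topspace[OF l] by (simp add: cch_topspace)
      fix q assume q: "q \<in> cch_hom Y unit_cch"
      show "q l = uf_to_exp ?X (filter_sets ?X \<Phi>) q"
        using uf_to_exp_eqI[OF \<Phi>X cch_hom_unit_preds[OF q] cch_hom_unit_limit[OF q l]] by simp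
    qed
    then show "limitin (ctop Y) (\<lambda>x. x) (?\<alpha> (uf_to_exp ?X (filter_sets (topspace (ctop Y)) \<Phi>))) \<Phi>"
      using l by (simp add: cch_topspace)
  qed
  then have "ctop (exp_alg_to_cch (obs_alg Y)) = ctop Y"
    by (simp add: exp_alg_to_cch_def Let_def acarrier_obs_alg cch_topspace)
  ultimately show ?thesis
    by (intro cch.equality) (simp_all add: ccarrier_exp_alg_to_cch acarrier_obs_alg)
qed

end

text \<open>The given structure map already solves the barycenter equations, and observability makes
  the solution unique.\<close>

lemma obs_alg_exp_alg_to_cch:
  assumes A: "is_exp_alg A" and obs: "observable_cch (exp_alg_to_cch A)"
  shows "obs_alg (exp_alg_to_cch A) = A"
proof (rule exp_alg.equality)
  let ?Y = "exp_alg_to_cch A"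
  note Y = is_cch_exp_alg[OF A]
  show "acarrier (obs_alg ?Y) = acarrier A"
    by (simp add: obs_alg_def ccarrier_exp_alg_to_cch)
  show "astruct (obs_alg ?Y) = astruct A"
  proof (rule PiE_ext)
    show "astruct (obs_alg ?Y) \<in> Exp (acarrier A) \<rightarrow>\<^sub>E acarrier A"
      using is_exp_alg_obs_alg[OF Y obs]
      by (simp add: is_exp_alg_def Let_def acarrier_obs_alg[OF Y obs] ccarrier_exp_alg_to_cch)
    show "astruct A \<in> Exp (acarrier A) \<rightarrow>\<^sub>E acarrier A"
      using A by (simp add: is_exp_alg_def Let_def)
    fix h assume h: "h \<in> Exp (acarrier A)"
    show "astruct (obs_alg ?Y) h = astruct A h"
      by (rule astruct_obs_alg_eqI[OF Y obs])
        (simp_all add: ccarrier_exp_alg_to_cch h exp_alg_closed[OF A] cch_hom_unit_astruct[OF A])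
  qed
qed simp

section \<open>The isomorphism of categories\<close>

lemma compose_PiE:
  "f \<in> X \<rightarrow>\<^sub>E Y \<Longrightarrow> g \<in> Y \<rightarrow>\<^sub>E Z \<Longrightarrow> compose X g f \<in> X \<rightarrow>\<^sub>E Z"
  by (auto simp: compose_def dest: PiE_mem)

lemma is_category_CCH: "is_category (CCH :: ('a cch, 'a \<Rightarrow> 'a) category)"
proof -
  have ident: "(\<lambda>x\<in>ccarrier Y. x) \<in> cch_hom Y Y" if Y: "is_cch Y" for Y :: "'a cch"
  proof -
    have "cconv Y \<phi> \<in> ccarrier Y" if "\<phi> \<in> Dist (ccarrier Y)" for \<phi>
      using Y that unfolding is_cch_def is_convex_structure_def by (auto dest: PiE_mem)
    moreover have "map_pmf (\<lambda>x\<in>ccarrier Y. x) \<phi> = \<phi>" if "\<phi> \<in> Dist (ccarrier Y)" for \<phi>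
    proof -
      have "map_pmf (\<lambda>x\<in>ccarrier Y. x) \<phi> = map_pmf (\<lambda>x. x) \<phi>"
        using that by (intro map_pmf_cong refl) (auto simp: Dist_def)
      then show ?thesis by simp
    qed
    moreover have "continuous_map (ctop Y) (ctop Y) (\<lambda>x\<in>ccarrier Y. x)"
      by (rule continuous_map_eq[of _ _ "\<lambda>x. x"]) (use Y in \<open>simp_all add: is_cch_def\<close>)
    ultimately show ?thesis by (simp add: cch_hom_def)
  qed
  have comp: "compose (ccarrier Y) g f \<in> cch_hom Y W"
    if Y: "is_cch Y" and f: "f \<in> cch_hom Y Z" and g: "g \<in> cch_hom Z W" for Y Z W :: "'a cch" and f g
  proof -
    have fYZ: "f \<in> ccarrier Y \<rightarrow>\<^sub>E ccarrier Z" and gZW: "g \<in> ccarrier Z \<rightarrow>\<^sub>E ccarrier W"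
      using f g by (simp_all add: cch_hom_def)
    have "compose (ccarrier Y) g f (cconv Y \<phi>) = cconv W (map_pmf (compose (ccarrier Y) g f) \<phi>)"
      if \<phi>: "\<phi> \<in> Dist (ccarrier Y)" for \<phi>
    proof -
      have "cconv Y \<phi> \<in> ccarrier Y"
        using Y \<phi> unfolding is_cch_def is_convex_structure_def by (auto dest: PiE_mem)
      then have "compose (ccarrier Y) g f (cconv Y \<phi>) = g (f (cconv Y \<phi>))" by (simp add: compose_def)
      also have "\<dots> = cconv W (map_pmf g (map_pmf f \<phi>))"
        using f g \<phi> map_pmf_Dist[OF \<phi> PiE_mem[OF fYZ]] by (simp add: cch_hom_def del: map_pmf_comp)
      also have "map_pmf g (map_pmf f \<phi>) = map_pmf (compose (ccarrier Y) g f) \<phi>"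
        unfolding map_pmf_comp using \<phi> by (intro map_pmf_cong refl) (auto simp: Dist_def compose_def)
      finally show ?thesis .
    qed
    moreover have "continuous_map (ctop Y) (ctop W) (compose (ccarrier Y) g f)"
    proof (rule continuous_map_eq)
      show "continuous_map (ctop Y) (ctop W) (g \<circ> f)"
        using f g by (intro continuous_map_compose) (auto simp: cch_hom_def)
      show "(g \<circ> f) x = compose (ccarrier Y) g f x" if "x \<in> topspace (ctop Y)" for x
        using that Y by (simp add: is_cch_def compose_def)
    qed
    ultimately show ?thesis using compose_PiE[OF fYZ gZW] by (simp add: cch_hom_def)
  qed
  have funs: "f \<in> ccarrier Y \<rightarrow>\<^sub>E ccarrier Z" if "f \<in> cch_hom Y Z" for f :: "'a \<Rightarrow> 'a" and Y Z
    using that by (simp add: cch_hom_def)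
  show ?thesis
    unfolding is_category_def CCH_def category.simps
  proof (intro conjI ballI)
    fix Y Z :: "'a cch" and f assume "f \<in> cch_hom Y Z"
    note f = funs[OF this]
    show "compose (ccarrier Y) f (\<lambda>x\<in>ccarrier Y. x) = f"
      using f by (auto simp: compose_def fun_eq_iff PiE_def extensional_def)
    show "compose (ccarrier Y) (\<lambda>x\<in>ccarrier Z. x) f = f"
      using f by (auto simp: compose_def fun_eq_iff PiE_def extensional_def)
  next
    fix Y Z W V :: "'a cch" and f g h assume "f \<in> cch_hom Y Z"
    note f = PiE_mem[OF funs[OF this]]
    show "compose (ccarrier Y) h (compose (ccarrier Y) g f) =
      compose (ccarrier Y) (compose (ccarrier Z) h g) f"
      using f by (auto simp: compose_def fun_eq_iff)
  qed (use ident comp in auto)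
qed

section \<open>Transfer of the category structure from spaces to algebras\<close>

lemma full_subcategory_simps:
  "obj (full_subcategory C P) = {A \<in> obj C. P A}" "hom (full_subcategory C P) = hom C"
  "ident (full_subcategory C P) = ident C" "cmp (full_subcategory C P) = cmp C"
  by (simp_all add: full_subcategory_def)

lemma is_category_full_subcategory: "is_category C \<Longrightarrow> is_category (full_subcategory C P)"
  unfolding is_category_def full_subcategory_simps by blast

lemma Alg_Exp_hom_eq:
  assumes "A \<in> obj Alg_Exp" "B \<in> obj Alg_Exp"
  shows "hom Alg_Exp A B = hom CCH (exp_alg_to_cch A) (exp_alg_to_cch B)"
  using assms by (simp add: Alg_Exp_def CCH_def cch_hom_exp_alg)

lemma Alg_Exp_ident_eq: "ident Alg_Exp A = ident CCH (exp_alg_to_cch A)"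
  by (simp add: Alg_Exp_def CCH_def ccarrier_exp_alg_to_cch)

lemma Alg_Exp_cmp_eq:
  "cmp Alg_Exp A B C = cmp CCH (exp_alg_to_cch A) (exp_alg_to_cch B) (exp_alg_to_cch C)"
  by (simp add: Alg_Exp_def CCH_def ccarrier_exp_alg_to_cch)

lemma exp_alg_to_cch_obj: "A \<in> obj Alg_Exp \<Longrightarrow> exp_alg_to_cch A \<in> obj CCH"
  by (simp add: Alg_Exp_def CCH_def is_cch_exp_alg)

text \<open>Each axiom is the axiom of \<open>CCH\<close> at the underlying spaces.\<close>

lemma is_category_Alg_Exp: "is_category (Alg_Exp :: ('a exp_alg, 'a \<Rightarrow> 'a) category)"
  using is_category_CCH[where 'a='a]
  unfolding is_category_def Alg_Exp_ident_eq Alg_Exp_cmp_eq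
  by (simp add: Alg_Exp_hom_eq exp_alg_to_cch_obj)

text \<open>Hom-sets, identities and composition of \<^const>\<open>Alg_Exp\<close> are those of \<^const>\<open>CCH\<close> on the
  underlying spaces, so only the bijection on objects is at issue.\<close>

theorem theorem5:
  shows "is_functor (Alg_Exp :: ('a exp_alg, 'a \<Rightarrow> 'a) category) CCH underlying_functor
    \<and> is_full (Alg_Exp :: ('a exp_alg, 'a \<Rightarrow> 'a) category) CCH underlying_functor
    \<and> is_faithful (Alg_Exp :: ('a exp_alg, 'a \<Rightarrow> 'a) category)
        (underlying_functor :: ('a exp_alg, 'a \<Rightarrow> 'a, 'a cch, 'a \<Rightarrow> 'a) functor_data)
    \<and> is_category_iso (Alg_Exp_obs :: ('a exp_alg, 'a \<Rightarrow> 'a) category) CCH_obs underlying_functor"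
proof -
  let ?U = "underlying_functor :: ('a exp_alg, 'a \<Rightarrow> 'a, 'a cch, 'a \<Rightarrow> 'a) functor_data"
  let ?G = "\<lparr>fobj = obs_alg, farr = (\<lambda>Y Z f. f)\<rparr> :: ('a cch, 'a \<Rightarrow> 'a, 'a exp_alg, 'a \<Rightarrow> 'a) functor_data"
  let ?A = "Alg_Exp :: ('a exp_alg, 'a \<Rightarrow> 'a) category"
  let ?C = "CCH :: ('a cch, 'a \<Rightarrow> 'a) category"
  have U: "fobj ?U = exp_alg_to_cch" "farr ?U = (\<lambda>A B f. f)"
    by (simp_all add: underlying_functor_def)
  have "is_functor ?A ?C ?U"
    unfolding is_functor_def U Alg_Exp_ident_eq Alg_Exp_cmp_eq
    by (simp add: is_category_Alg_Exp is_category_CCH exp_alg_to_cch_obj Alg_Exp_hom_eq)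
  moreover have "is_full ?A ?C ?U"
    unfolding is_full_def U by (simp add: Alg_Exp_hom_eq)
  moreover have "is_faithful ?A ?U"
    unfolding is_faithful_def U by simp
  moreover have "is_category_iso Alg_Exp_obs CCH_obs ?U"
  proof -
    let ?Ao = "Alg_Exp_obs :: ('a exp_alg, 'a \<Rightarrow> 'a) category"
    let ?Co = "CCH_obs :: ('a cch, 'a \<Rightarrow> 'a) category"
    note sub = Alg_Exp_obs_def CCH_obs_def full_subcategory_simps
    have cat: "is_category ?Ao" "is_category ?Co"
      unfolding Alg_Exp_obs_def CCH_obs_def
      by (intro is_category_full_subcategory is_category_Alg_Exp is_category_CCH)+
    have objU: "exp_alg_to_cch A \<in> obj ?Co" "A \<in> obj ?A" if "A \<in> obj ?Ao" for A
      using that by (simp_all add: sub exp_alg_to_cch_obj observable_exp_alg_def)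
    have GU: "obs_alg (exp_alg_to_cch A) = A" if "A \<in> obj ?Ao" for A
      using that by (simp add: sub Alg_Exp_def observable_exp_alg_def obs_alg_exp_alg_to_cch)
    have UG: "exp_alg_to_cch (obs_alg Y) = Y" if "Y \<in> obj ?Co" for Y
      using that by (simp add: sub CCH_def exp_alg_to_cch_obs_alg)
    have objG: "obs_alg Y \<in> obj ?Ao" if "Y \<in> obj ?Co" for Y
      using that by (simp add: sub CCH_def Alg_Exp_def observable_exp_alg_def
        exp_alg_to_cch_obs_alg is_exp_alg_obs_alg)
    have homU: "hom ?Ao A B = hom ?Co (exp_alg_to_cch A) (exp_alg_to_cch B)"
      if "A \<in> obj ?Ao" "B \<in> obj ?Ao" for A B
      using that by (simp add: sub Alg_Exp_hom_eq)
    have identU: "ident ?Ao A = ident ?Co (exp_alg_to_cch A)" for A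
      unfolding sub by (rule Alg_Exp_ident_eq)
    have cmpU: "cmp ?Ao A B D = cmp ?Co (exp_alg_to_cch A) (exp_alg_to_cch B) (exp_alg_to_cch D)" for A B D
      unfolding sub by (rule Alg_Exp_cmp_eq)
    have "is_functor ?Ao ?Co ?U"
      unfolding is_functor_def U identU cmpU by (simp add: cat objU homU)
    \<comment> \<open>Rewriting the structure of \<open>?Ao\<close> into that of \<open>?Co\<close>
      produces the space underlying \<open>obs_alg Y\<close>, which \<open>UG\<close> replaces by
      \<open>Y\<close>.\<close>
    moreover have "is_functor ?Co ?Ao ?G"
      unfolding is_functor_def functor_data.simps identU cmpU by (simp add: cat objG homU UG)
    ultimately show ?thesis
      unfolding is_category_iso_def U
      by (intro conjI exI[of _ ?G]) (simp_all add: GU UG)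
  qed
  ultimately show ?thesis by blast
qed

end
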